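(* Let $D$ be a $\chi$-colored diagram of an oriented link $L\subset S^3$ in which every component passes through at least one crossing. At each crossing of sign $\epsilon\in\{1,-1\}$ (with the labelling of segments and regions described in the context) assign to the edges of the ideal octahedron at that crossing the vertical edge shapes $$o_1=\frac{a_1^{\epsilon}}{m_1},\qquad o_2=\frac{1}{m_2a_2^{\epsilon}},\qquad o_{1'}=\frac{m_1}{a_{1'}^{\epsilon}},\qquad o_{2'}=m_2a_{2'}^{\epsilon},$$ and the horizontal edge shapes $$o_N=\frac{b_{2'}}{b_1},\qquad o_W=\frac{m_1b_1}{b_2},\qquad o_S=\frac{m_2b_2}{m_1b_{1'}},\qquad o_E=\frac{b_{1'}}{m_2b_{2'}}.$$ Then these shapes satisfy the gluing equations of the octahedral decomposition of $S^3\setminus(L\cup\{P_+,P_-\})$ determined by $D$, namely the region, over-arc and under-arc equations listed in the context.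
   Context: **Crossings.** A segment of $D$ is an edge of the underlying 4-valent planar graph, a region is a component of its complement in $S^2$. Each crossing is drawn with both strands running left to right: incoming segments $1$ (top left), $2$ (bottom left); outgoing segments $2'$ (top right), $1'$ (bottom right); the strands run $1\to1'$ and $2\to2'$. At a positive crossing $1\to1'$ passes over; at a negative crossing $2\to2'$ passes over. The adjacent regions are $N$ (between $1,2'$), $W$ (between $1,2$), $S$ (between $2,1'$), $E$ (between $2',1'$). **$\chi$-colorings.** A $\chi$-color is $(a,b,m)\in(\mathbb C^\times)^3$. The partial map $B(\chi_1,\chi_2)=(\chi_{2'},\chi_{1'})$ is given by $m_{1'}=m_1$, $m_{2'}=m_2$, $a_{1'}=a_1A^{-1}$, $a_{2'}=a_2A$ with $A=1-\frac{m_1b_1}{b_2}(1-\frac{a_1}{m_1})(1-\frac1{m_2a_2})$, and $$b_{1'}=\tfrac{m_2b_2}{m_1}\bigl(1-m_2a_2(1-\tfrac{b_2}{m_1b_1})\bigr)^{-1},\quad b_{2'}=b_1\bigl(1-\tfrac{m_1}{a_1}(1-\tfrac{b_2}{m_1b_1})\bigr).$$ Its inverse $B^{-1}(\chi_1,\chi_2)=(\chi_{2'},\chi_{1'})$ is given by $m_{1'}=m_1$, $m_{2'}=m_2$, $a_{1'}=a_1\tilde A^{-1}$, $a_{2'}=a_2\tilde A$ with $\tilde A=1-\frac{b_2}{m_1b_1}(1-m_1a_1)(1-\frac{m_2}{a_2})$, and $$b_{1'}=\tfrac{m_2b_2}{m_1}\bigl(1-\tfrac{a_2}{m_2}(1-\tfrac{m_1b_1}{b_2})\bigr),\quad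 b_{2'}=b_1\bigl(1-\tfrac1{m_1a_1}(1-\tfrac{m_1b_1}{b_2})\bigr)^{-1}.$$ $D$ is $\chi$-colored if each segment $i$ has a color $\chi_i=(a_i,b_i,m_i)\in(\mathbb C^\times)^3$ with $B(\chi_1,\chi_2)=(\chi_{2'},\chi_{1'})$ at positive crossings and $B^{-1}(\chi_1,\chi_2)=(\chi_{2'},\chi_{1'})$ at negative crossings. **Octahedral decomposition and its gluing equations.** One places an ideal octahedron at each crossing, with top and bottom ideal vertices on the over- and under-strand and the remaining four alternately pulled above the diagram to a point $P_+$ or below it to a point $P_-$. Gluing yields an ideal decomposition of $S^3\setminus(L\cup\{P_+,P_-\})$. There is one horizontal edge of the octahedron for each of the four corners $N,W,S,E$ of the crossing (shape $o_k$ for corner $k$). The shape $o_j$ belongs to the vertical edge immediately below (if $j$ is on the over-strand) or above (if $j$ is on the under-strand) segment $j$. The two remaining vertical edges at the ideal vertex of a strand with incoming/outgoing segments $j,j'$ are glued to each other and contribute together $(o_jo_{j'})^{-1}$. The gluing equations (product of the shapes of all edges identified together equals $1$) are: 1. Region equations: for each region, the product of the horizontal shapes of all crossing corners in that region is $1$. 2. Over-arc equations: for each maximal piece of a link component with no undercrossing in its interior, beginning by leaving an undercrossing along segment $s$ and ending by entering an undercrossing along segment $t$: $o_s\cdot o_t\cdot\prod (o_jo_{j'})^{-1}=1$, where $o_s$ is taken at the starting crossing, $o_t$ at the ending crossing, and the product is over the overcrossings traversed in between, with $j,j'$ the incoming and outgoing segments there. For a component with no undercrossings the factors $o_s,o_t$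 are omitted and the product is over all its crossings. 3. Under-arc equations: the same with "over" and "under" exchanged. *)

theory Defs
  imports "HOL-Analysis.Analysis"
begin

section \<open>Oriented link diagrams on the sphere\<close>

text \<open>
  A diagram is a generic immersion of finitely many oriented circles in the unit sphere,
  together with over/under information at the double points.  The circles are
  parametrised by 1-periodic maps on the reals; a point of the disjoint union of circles is
  a pair \<open>(i, s)\<close> with \<open>i\<close> the number of the component and \<open>0 \<le> s < 1\<close>.
  The value of \<open>over\<close> matters only at the preimages of double points.
\<close>

record diagram =
  ncomps :: nat
  curve :: "nat \<Rightarrow> real \<Rightarrow> real^3"
  over :: "nat \<times> real \<Rightarrow> bool"

definition points :: "diagram \<Rightarrow> (nat \<times> real) set" where
  "points D = {(i, s). i < ncomps D \<and> 0 \<le> s \<and> s < 1}"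

definition pos :: "diagram \<Rightarrow> nat \<times> real \<Rightarrow> real^3" where
  "pos D v = curve D (fst v) (snd v)"

definition vel :: "diagram \<Rightarrow> nat \<times> real \<Rightarrow> real^3" where
  "vel D v = vector_derivative (curve D (fst v)) (at (snd v))"

text \<open>
  The sphere is oriented by its outward normal: \<open>orient p u w > 0\<close> says that the tangent
  vectors \<open>u\<close>, \<open>w\<close> at \<open>p\<close> form a counterclockwise frame, seen from outside.
\<close>

definition orient :: "real^3 \<Rightarrow> real^3 \<Rightarrow> real^3 \<Rightarrow> real" where
  "orient p u w = p \<bullet> cross3 u w"

definition double_pairs :: "diagram \<Rightarrow> ((nat \<times> real) \<times> (nat \<times> real)) set" where
  "double_pairs D = {(v, w). v \<in> points D \<and> w \<in> points D \<and> v \<noteq> w \<and> pos D v = pos D w}"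

definition link_diagram :: "diagram \<Rightarrow> bool" where
  "link_diagram D \<longleftrightarrow>
     (\<forall>i < ncomps D.
        curve D i C1_differentiable_on UNIV \<and>
        (\<forall>t. curve D i t \<in> sphere 0 1 \<and> curve D i (t + 1) = curve D i t \<and>
             vector_derivative (curve D i) (at t) \<noteq> 0)) \<and>
     finite (double_pairs D) \<and>
     (\<forall>(v, w) \<in> double_pairs D. orient (pos D v) (vel D v) (vel D w) \<noteq> 0) \<and>
     (\<forall>v w x. (v, w) \<in> double_pairs D \<and> (v, x) \<in> double_pairs D \<longrightarrow> w = x) \<and>
     (\<forall>(v, w) \<in> double_pairs D. over D v \<longleftrightarrow> \<not> over D w)"

text \<open>
  A crossing is recorded as the pair of its two strands \<open>1 \<rightarrow> 1'\<close> and \<open>2 \<rightarrow> 2'\<close>.  When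
  both are drawn running from left to right, \<open>1 \<rightarrow> 1'\<close> descends and \<open>2 \<rightarrow> 2'\<close> ascends, so the
  orientation condition tells which strand is which, and each double point gives
  exactly one crossing.
\<close>

type_synonym crossing = "(nat \<times> real) \<times> (nat \<times> real)"

definition crossings :: "diagram \<Rightarrow> crossing set" where
  "crossings D = {(v, w) \<in> double_pairs D. orient (pos D v) (vel D v) (vel D w) > 0}"

definition crossing_sign :: "diagram \<Rightarrow> crossing \<Rightarrow> int" where
  "crossing_sign D c = (if over D (fst c) then 1 else -1)"

definition visits :: "diagram \<Rightarrow> (nat \<times> real) set" where
  "visits D = fst ` crossings D \<union> snd ` crossings D"

definition crossing_of :: "diagram \<Rightarrow> nat \<times> real \<Rightarrow> crossing" where
  "crossing_of D v = (THE c. c \<in> crossings D \<and> (v = fst c \<or> v = snd c))"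

definition crossing_param :: "diagram \<Rightarrow> nat \<Rightarrow> real \<Rightarrow> bool" where
  "crossing_param D i r \<longleftrightarrow> (i, frac r) \<in> visits D"

text \<open>
  Segments are the (open) edges of the 4-valent graph: the images of the parameter
  intervals between successive crossings of a component.
\<close>

definition out_segment :: "diagram \<Rightarrow> nat \<times> real \<Rightarrow> (real^3) set" where
  "out_segment D v =
     curve D (fst v) ` {snd v <..< (LEAST t. snd v < t \<and> crossing_param D (fst v) t)}"

definition in_segment :: "diagram \<Rightarrow> nat \<times> real \<Rightarrow> (real^3) set" where
  "in_segment D v =
     curve D (fst v) ` {(GREATEST t. t < snd v \<and> crossing_param D (fst v) t) <..< snd v}"

definition segments :: "diagram \<Rightarrow> (real^3) set set" where
  "segments D = out_segment D ` visits D"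

definition regions :: "diagram \<Rightarrow> (real^3) set set" where
  "regions D = components (sphere 0 1 - (\<Union>i < ncomps D. range (curve D i)))"

datatype corner = North | West | South | East

text \<open>
  A tangent vector at the crossing pointing into the given corner: for instance the northern
  corner lies between segment \<open>1\<close> (direction \<open>- u\<close>) and segment \<open>2'\<close> (direction \<open>w\<close>).
\<close>

fun corner_vec :: "diagram \<Rightarrow> crossing \<Rightarrow> corner \<Rightarrow> real^3" where
  "corner_vec D (v, w) North = vel D w - vel D v"
| "corner_vec D (v, w) West = - vel D v - vel D w"
| "corner_vec D (v, w) South = vel D v - vel D w"
| "corner_vec D (v, w) East = vel D v + vel D w"

text \<open>Here \<open>sgn\<close> normalises a vector, i.e. projects it radially to the unit sphere.\<close>

definition corner_in :: "diagram \<Rightarrow> crossing \<Rightarrow> corner \<Rightarrow> (real^3) set \<Rightarrow> bool" where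
  "corner_in D c k R \<longleftrightarrow>
     (\<forall>\<^sub>F e in at_right 0. sgn (pos D (fst c) + e *\<^sub>R corner_vec D c k) \<in> R)"

section \<open>Colorings\<close>

record chi_color =
  ca :: complex
  cb :: complex
  cm :: complex

definition is_chi_color :: "chi_color \<Rightarrow> bool" where
  "is_chi_color x \<longleftrightarrow> ca x \<noteq> 0 \<and> cb x \<noteq> 0 \<and> cm x \<noteq> 0"

text \<open>
  The partial maps send \<open>(\<chi>\<^sub>1, \<chi>\<^sub>2)\<close> to \<open>(\<chi>\<^sub>2\<^sub>', \<chi>\<^sub>1\<^sub>')\<close>; they are defined where the
  formulas make sense and yield nonzero coordinates.
\<close>

definition B_map :: "chi_color \<times> chi_color \<Rightarrow> (chi_color \<times> chi_color) option" where
  "B_map = (\<lambda>(x1, x2).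
     let a1 = ca x1; b1 = cb x1; m1 = cm x1;
         a2 = ca x2; b2 = cb x2; m2 = cm x2;
         A = 1 - m1 * b1 / b2 * (1 - a1 / m1) * (1 - 1 / (m2 * a2));
         P = 1 - m2 * a2 * (1 - b2 / (m1 * b1));
         Q = 1 - m1 / a1 * (1 - b2 / (m1 * b1))
     in if is_chi_color x1 \<and> is_chi_color x2 \<and> A \<noteq> 0 \<and> P \<noteq> 0 \<and> Q \<noteq> 0
        then Some (\<lparr>ca = a2 * A, cb = b1 * Q, cm = m2\<rparr>,
                   \<lparr>ca = a1 * inverse A, cb = m2 * b2 / m1 * inverse P, cm = m1\<rparr>)
        else None)"

definition B_inv_map :: "chi_color \<times> chi_color \<Rightarrow> (chi_color \<times> chi_color) option" where
  "B_inv_map = (\<lambda>(x1, x2).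
     let a1 = ca x1; b1 = cb x1; m1 = cm x1;
         a2 = ca x2; b2 = cb x2; m2 = cm x2;
         A = 1 - b2 / (m1 * b1) * (1 - m1 * a1) * (1 - m2 / a2);
         P = 1 - a2 / m2 * (1 - m1 * b1 / b2);
         Q = 1 - 1 / (m1 * a1) * (1 - m1 * b1 / b2)
     in if is_chi_color x1 \<and> is_chi_color x2 \<and> A \<noteq> 0 \<and> P \<noteq> 0 \<and> Q \<noteq> 0
        then Some (\<lparr>ca = a2 * A, cb = b1 * inverse Q, cm = m2\<rparr>,
                   \<lparr>ca = a1 * inverse A, cb = m2 * b2 / m1 * P, cm = m1\<rparr>)
        else None)"

datatype label = In1 | In2 | Out1 | Out2 \<comment> \<open>the segments \<open>1\<close>, \<open>2\<close>, \<open>1'\<close>, \<open>2'\<close> at a crossing\<close>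

fun segment_at :: "diagram \<Rightarrow> crossing \<Rightarrow> label \<Rightarrow> (real^3) set" where
  "segment_at D (v, w) In1 = in_segment D v"
| "segment_at D (v, w) In2 = in_segment D w"
| "segment_at D (v, w) Out1 = out_segment D v"
| "segment_at D (v, w) Out2 = out_segment D w"

definition chi_colored :: "diagram \<Rightarrow> ((real^3) set \<Rightarrow> chi_color) \<Rightarrow> bool" where
  "chi_colored D col \<longleftrightarrow>
     (\<forall>S \<in> segments D. is_chi_color (col S)) \<and>
     (\<forall>c \<in> crossings D.
        (if crossing_sign D c = 1 then B_map else B_inv_map)
          (col (segment_at D c In1), col (segment_at D c In2)) =
        Some (col (segment_at D c Out2), col (segment_at D c Out1)))"

section \<open>Edge shapes of the octahedra and the gluing equations\<close>

text \<open>
  An assignment of shapes consists of \<open>ov c l\<close>, the shape of the vertical edge of the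
  octahedron at \<open>c\<close> next to the segment labelled \<open>l\<close>, and \<open>oh c k\<close>, the shape of its
  horizontal edge at the corner \<open>k\<close>.
\<close>

definition shape_in :: "diagram \<Rightarrow> (crossing \<Rightarrow> label \<Rightarrow> complex) \<Rightarrow> nat \<times> real \<Rightarrow> complex" where
  "shape_in D ov v =
     (let c = crossing_of D v in ov c (if v = fst c then In1 else In2))"

definition shape_out :: "diagram \<Rightarrow> (crossing \<Rightarrow> label \<Rightarrow> complex) \<Rightarrow> nat \<times> real \<Rightarrow> complex" where
  "shape_out D ov v =
     (let c = crossing_of D v in ov c (if v = fst c then Out1 else Out2))"

definition region_equations :: "diagram \<Rightarrow> (crossing \<Rightarrow> corner \<Rightarrow> complex) \<Rightarrow> bool" where
  "region_equations D oh \<longleftrightarrow>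
     (\<forall>R \<in> regions D.
        (\<Prod>(c, k) \<in> {(c, k). c \<in> crossings D \<and> corner_in D c k R}. oh c k) = 1)"

text \<open>
  \<open>arc_equations D ov x\<close> are the over-arc equations if \<open>x\<close> is true and the under-arc
  equations if \<open>x\<close> is false.  An arc is a piece of component \<open>i\<close> over a parameter interval
  \<open>[s, t]\<close> between successive crossings of the opposite kind.  The parameters are
  not reduced modulo \<open>1\<close>, so that an arc may run through the base point of its component,
  and may run all the way round it when its two ends lie at the same crossing
  (\<open>t = s + 1\<close>).
\<close>

definition arc_end :: "diagram \<Rightarrow> bool \<Rightarrow> nat \<Rightarrow> real \<Rightarrow> bool" where
  "arc_end D x i r \<longleftrightarrow> crossing_param D i r \<and> over D (i, frac r) \<noteq> x"

definition arc_equations :: "diagram \<Rightarrow> (crossing \<Rightarrow> label \<Rightarrow> complex) \<Rightarrow> bool \<Rightarrow> bool" where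
  "arc_equations D ov x \<longleftrightarrow>
     (\<forall>i < ncomps D. \<forall>s t. s < t \<and> arc_end D x i s \<and> arc_end D x i t \<and>
        (\<forall>r \<in> {s<..<t}. \<not> arc_end D x i r) \<longrightarrow>
        shape_out D ov (i, frac s) * shape_in D ov (i, frac t) *
          (\<Prod>r \<in> {r \<in> {s<..<t}. crossing_param D i r}.
             inverse (shape_in D ov (i, frac r) * shape_out D ov (i, frac r))) = 1) \<and>
     (\<forall>i < ncomps D. (\<forall>r. \<not> arc_end D x i r) \<longrightarrow>
        (\<Prod>r \<in> {r \<in> {0..<1}. crossing_param D i r}.
           inverse (shape_in D ov (i, frac r) * shape_out D ov (i, frac r))) = 1)"

definition gluing_equations ::
    "diagram \<Rightarrow> (crossing \<Rightarrow> label \<Rightarrow> complex) \<Rightarrow> (crossing \<Rightarrow> corner \<Rightarrow> complex) \<Rightarrow> bool" where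
  "gluing_equations D ov oh \<longleftrightarrow>
     region_equations D oh \<and> arc_equations D ov True \<and> arc_equations D ov False"

definition vertical_shape ::
    "diagram \<Rightarrow> ((real^3) set \<Rightarrow> chi_color) \<Rightarrow> crossing \<Rightarrow> label \<Rightarrow> complex" where
  "vertical_shape D col c l =
     (let x = col (segment_at D c l);
          m1 = cm (col (segment_at D c In1));
          m2 = cm (col (segment_at D c In2));
          \<epsilon> = crossing_sign D c
      in case l of
           In1 \<Rightarrow> ca x powi \<epsilon> / m1
         | In2 \<Rightarrow> 1 / (m2 * ca x powi \<epsilon>)
         | Out1 \<Rightarrow> m1 / ca x powi \<epsilon>
         | Out2 \<Rightarrow> m2 * ca x powi \<epsilon>)"

definition horizontal_shape ::
    "diagram \<Rightarrow> ((real^3) set \<Rightarrow> chi_color) \<Rightarrow> crossing \<Rightarrow> corner \<Rightarrow> complex" where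
  "horizontal_shape D col c k =
     (let m1 = cm (col (segment_at D c In1));
          m2 = cm (col (segment_at D c In2));
          b1 = cb (col (segment_at D c In1));
          b2 = cb (col (segment_at D c In2));
          b1' = cb (col (segment_at D c Out1));
          b2' = cb (col (segment_at D c Out2))
      in case k of
           North \<Rightarrow> b2' / b1
         | West \<Rightarrow> m1 * b1 / b2
         | South \<Rightarrow> m2 * b2 / (m1 * b1')
         | East \<Rightarrow> b1' / (m2 * b2'))"

end

theory Submission
  imports Defs
begin

text \<open>
  The octahedral shapes factor over the segments.  Put the weights \<open>b\<close> and \<open>1 / (m b)\<close> on
  the left and right side of a segment with color \<open>(a, b, m)\<close> at its starting point, and
  their inverses at its end point; then the shape of each corner is the product of
  the weights of its two bounding half-segments.  Pushing a segment off itself to one side gives a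
  path in the complement of the diagram, so the two corners on that side of it lie in
  the same region and its weights cancel there.  Likewise the vertical shapes are \<open>a / m\<close>
  before and \<open>m / a\<close> after an overcrossing (with \<open>a\<close> inverted at an undercrossing), whatever the
  sign, so the arc equations telescope.

  The topological input is local.  If \<open>d\<close> is transversal to a curve \<open>g\<close> on the sphere, then
  \<open>g x + e d\<close> cannot be proportional to \<open>g y\<close> for \<open>x\<close>, \<open>y\<close> close together, because \<open>g x\<close>, the
  chord from \<open>g x\<close> to \<open>g y\<close> and \<open>d\<close> are linearly independent.  Near a crossing \<open>p\<close> of \<open>g\<close> and \<open>h\<close>,
  the same argument shows that \<open>g x + h y - p\<close> stays off both strands.
\<close>

section \<open>Transversal push-offs\<close>

lemma orient_combination: "orient p u (a *\<^sub>R p + b *\<^sub>R u) = 0"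
  by (simp add: orient_def cross_add_right cross_mult_right inner_add_right dot_cross_self)

lemma orient_skew: "orient p u w = - orient p w u"
  unfolding orient_def by (metis cross_skew inner_minus_right)

lemma continuous_orient [continuous_intros]:
  "continuous F f \<Longrightarrow> continuous F g \<Longrightarrow> continuous F h \<Longrightarrow> continuous F (\<lambda>x. orient (f x) (g x) (h x))"
  unfolding orient_def by (intro continuous_intros continuous_cross)

text \<open>Transversality is an open condition jointly in the base point, the tangent and the push
  direction. All three move in the push-off argument, so one radius is taken for them
  together.\<close>

lemma orient_nonzero_near:
  assumes "orient p u k \<noteq> 0"
  shows "\<exists>d>0. \<forall>p' u' k'. dist p' p < d \<longrightarrow> dist u' u < d \<longrightarrow> dist k' k < d \<longrightarrow> orient p' u' k' \<noteq> 0"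
proof -
  let ?f = "\<lambda>z. orient (fst z) (fst (snd z)) (snd (snd z))"
  have "isCont ?f (p, u, k)"
    by (intro continuous_intros)
  moreover have "?f (p, u, k) \<noteq> 0" using assms by simp
  ultimately obtain e where e: "e > 0" "\<And>z. dist (p, u, k) z < e \<Longrightarrow> ?f z \<noteq> 0"
    using continuous_at_avoid[of "(p, u, k)" ?f 0] by blast
  \<comment> \<open>Two triples are no further apart than the sum of the distances of their entries,
    hence the thirds.\<close>
  have "orient p' u' k' \<noteq> 0"
    if "dist p' p < e / 3" "dist u' u < e / 3" "dist k' k < e / 3" for p' u' k'
  proof -
    have "dist (p, u, k) (p', u', k') \<le> dist p p' + (dist u u' + dist k k')"
      unfolding dist_Pair_Pair
      by (meson add_left_mono order_trans sqrt_sum_squares_le_sum zero_le_dist real_sqrt_ge_zero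
          sum_power2_ge_zero)
    then show ?thesis
      using e(2)[of "(p', u', k')"] that by (simp add: dist_commute)
  qed
  with e(1) show ?thesis by (intro exI[of _ "e / 3"]) auto
qed

text \<open>Mean value inequality for \<open>g\<close> minus the linear function with slope
  \<open>?u\<close>; its derivative is small near \<open>t\<close> because the derivative of
  \<open>g\<close> is continuous. The estimate is uniform over pairs near \<open>t\<close>, since
  both ends of a chord will vary.\<close>

lemma C1_strict_derivative:
  fixes g :: "real \<Rightarrow> 'a::euclidean_space"
  assumes "g C1_differentiable_on UNIV" "e > 0"
  shows "\<exists>d>0. \<forall>x y. dist x t < d \<and> dist y t < d \<longrightarrow>
    norm (g y - g x - (y - x) *\<^sub>R vector_derivative g (at t)) \<le> e * \<bar>y - x\<bar>"
proof -
  have diff: "g differentiable at x" for x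
    using assms(1) by (auto simp: C1_differentiable_on_eq)
  have cont: "continuous_on UNIV (\<lambda>x. vector_derivative g (at x))"
    using assms(1) by (auto simp: C1_differentiable_on_eq)
  let ?u = "vector_derivative g (at t)"
  have "isCont (\<lambda>x. vector_derivative g (at x)) t"
    using cont by (simp add: continuous_on_eq_continuous_at)
  then obtain d where d: "d > 0" "\<And>x. dist x t < d \<Longrightarrow> dist (vector_derivative g (at x)) ?u < e"
    using assms(2) unfolding continuous_at_eps_delta by blast
  have "norm (g y - g x - (y - x) *\<^sub>R ?u) \<le> e * \<bar>y - x\<bar>"
    if "dist x t < d" "dist y t < d" for x y
  proof -
    have der: "((\<lambda>z. g z - z *\<^sub>R ?u) has_derivative
        (\<lambda>h. h *\<^sub>R (vector_derivative g (at z) - ?u))) (at z within ball t d)" for z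
    proof -
      have "(g has_derivative (\<lambda>h. h *\<^sub>R vector_derivative g (at z))) (at z within ball t d)"
        using diff[of z] vector_derivative_works has_vector_derivative_def has_derivative_at_withinI
        by metis
      then show ?thesis
        by (auto intro!: derivative_eq_intros simp: scaleR_diff_right)
    qed
    have on: "onorm (\<lambda>h. h *\<^sub>R (vector_derivative g (at z) - ?u)) \<le> e" if "z \<in> ball t d" for z
    proof (rule onorm_bound)
      fix h :: real
      have "norm (vector_derivative g (at z) - ?u) \<le> e"
        using d(2)[of z] that by (simp add: dist_norm dist_commute norm_minus_commute less_imp_le)
      then have "norm (vector_derivative g (at z) - ?u) * \<bar>h\<bar> \<le> e * \<bar>h\<bar>"
        by (rule mult_right_mono) simp
      then show "norm (h *\<^sub>R (vector_derivative g (at z) - ?u)) \<le> e * norm h"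
        by (simp add: mult.commute)
    qed (use assms(2) in simp)
    have "norm ((g y - y *\<^sub>R ?u) - (g x - x *\<^sub>R ?u)) \<le> e * norm (y - x)"
      by (rule differentiable_bound[OF convex_ball der on])
        (use that in \<open>auto simp: dist_commute\<close>)
    then show ?thesis by (simp add: algebra_simps)
  qed
  with d(1) show ?thesis by blast
qed

text \<open>Independence of the three vectors is insensitive to scaling, so \<open>e\<close> may be
  any nonzero real. Letting the direction \<open>k'\<close> vary allows secants of another strand to
  serve as push directions.\<close>

lemma transversal_pushoff_avoids_curve:
  fixes g :: "real \<Rightarrow> real^3"
  assumes C1: "g C1_differentiable_on UNIV"
    and tr: "orient (g t) (vector_derivative g (at t)) k \<noteq> 0"
  shows "\<exists>d>0. \<forall>x y k' e. dist x t < d \<and> dist y t < d \<and> dist k' k < d \<and> e \<noteq> 0 \<longrightarrow>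
    sgn (g x + e *\<^sub>R k') \<noteq> g y"
proof -
  let ?u = "vector_derivative g (at t)"
  obtain e1 where e1: "e1 > 0" "\<And>p' u' k'. dist p' (g t) < e1 \<Longrightarrow> dist u' ?u < e1 \<Longrightarrow> dist k' k < e1 \<Longrightarrow>
      orient p' u' k' \<noteq> 0"
    using orient_nonzero_near[OF tr] by blast
  have "isCont g t"
    using C1 by (metis C1_differentiable_on_eq UNIV_I differentiable_imp_continuous_within)
  then obtain e3 where e3: "e3 > 0" "\<And>x. dist x t < e3 \<Longrightarrow> dist (g x) (g t) < e1"
    using e1(1) unfolding continuous_at_eps_delta by blast
  obtain e4 where e4: "e4 > 0" "\<And>x y. dist x t < e4 \<Longrightarrow> dist y t < e4 \<Longrightarrow>
      norm (g y - g x - (y - x) *\<^sub>R ?u) \<le> e1 / 2 * \<bar>y - x\<bar>"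
    using C1_strict_derivative[OF C1, of "e1 / 2" t] e1(1) by auto
  define d where "d = min e1 (min e3 e4)"
  have "sgn (g x + e *\<^sub>R k') \<noteq> g y"
    if x: "dist x t < d" and y: "dist y t < d" and k': "dist k' k < d" and e: "e \<noteq> 0" for x y k' e
  proof
    assume eq: "sgn (g x + e *\<^sub>R k') = g y"
    define r where "r = norm (g x + e *\<^sub>R k')"
    have "v = norm v *\<^sub>R sgn v" for v :: "real^3"
      by (cases "v = 0") (simp_all add: sgn_div_norm)
    then have r: "g x + e *\<^sub>R k' = r *\<^sub>R g y"
      unfolding eq[symmetric] r_def .
    define w where "w = (if x = y then ?u else (g y - g x) /\<^sub>R (y - x))"
    have gy: "g y = g x + (y - x) *\<^sub>R w"
      by (simp add: w_def)
    have "dist w ?u < e1"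
    proof (cases "x = y")
      case False
      have "(y - x) *\<^sub>R (w - ?u) = g y - g x - (y - x) *\<^sub>R ?u"
        unfolding gy by (simp add: algebra_simps)
      then have "\<bar>y - x\<bar> * norm (w - ?u) \<le> e1 / 2 * \<bar>y - x\<bar>"
        using e4(2)[of x y] x y unfolding d_def by (metis min_less_iff_conj norm_scaleR)
      with False have "norm (w - ?u) \<le> e1 / 2" by (simp add: mult.commute)
      with e1(1) show ?thesis by (simp add: dist_norm)
    qed (simp add: w_def e1)
    then have "orient (g x) w k' \<noteq> 0"
      using e1(2) e3(2) x k' by (simp add: d_def)
    \<comment> \<open>Inserting \<open>gy\<close> into \<open>r\<close> places \<open>k'\<close> in
      the span of \<open>g x\<close> and \<open>w\<close>, where \<open>orient\<close>
      vanishes.\<close>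
    moreover have *: "e *\<^sub>R k' = (r - 1) *\<^sub>R g x + (r * (y - x)) *\<^sub>R w"
      using r unfolding gy by (simp add: algebra_simps)
    have "k' = ((r - 1) / e) *\<^sub>R g x + (r * (y - x) / e) *\<^sub>R w"
      using arg_cong[OF *, of "\<lambda>v. v /\<^sub>R e"] e by (simp add: scaleR_right_distrib divide_inverse mult.commute)
    then have "orient (g x) w k' = 0"
      using orient_combination by metis
    ultimately show False by simp
  qed
  moreover have "d > 0" using e1 e3 e4 by (simp add: d_def)
  ultimately show ?thesis by blast
qed

section \<open>Points near the diagram\<close>

definition complement :: "diagram \<Rightarrow> (real^3) set" where
  "complement D = sphere 0 1 - (\<Union>i < ncomps D. range (curve D i))"

text \<open>The condition in \<open>corner_in\<close>, for an arbitrary base point and direction.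
  Corners at crossings can then be compared with one-sided germs at interior points of
  segments.\<close>

definition germ_in :: "real^3 \<Rightarrow> real^3 \<Rightarrow> (real^3) set \<Rightarrow> bool" where
  "germ_in p d R \<longleftrightarrow> (\<forall>\<^sub>F e in at_right 0. sgn (p + e *\<^sub>R d) \<in> R)"

text \<open>A region is a maximal connected part of the complement, so it contains all or none of a
  connected family of points off the diagram.\<close>

lemma region_connected_family:
  assumes R: "R \<in> regions D" and "connected P" "continuous_on P F"
    and U: "\<And>z. z \<in> P \<Longrightarrow> sgn (F z) \<in> complement D" and z: "z \<in> P" "z' \<in> P"
  shows "sgn (F z) \<in> R \<longleftrightarrow> sgn (F z') \<in> R"
proof -
  \<comment> \<open>Points of the complement have norm 1 while \<open>sgn 0 = 0\<close>; hence
    \<open>F\<close> avoids 0 and projecting it to the sphere is continuous.\<close>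
  have nz: "F z \<noteq> 0" if "z \<in> P" for z
    using U[OF that] by (auto simp: complement_def)
  have "connected ((\<lambda>z. sgn (F z)) ` P)"
    using assms(2,3) nz by (intro connected_continuous_image continuous_on_sgn) auto
  moreover have "(\<lambda>z. sgn (F z)) ` P \<subseteq> complement D"
    using U by auto
  ultimately have "(\<lambda>z. sgn (F z)) ` P \<subseteq> R" if "R \<inter> (\<lambda>z. sgn (F z)) ` P \<noteq> {}"
    using components_maximal R that unfolding regions_def complement_def by metis
  with z show ?thesis by blast
qed

text \<open>The initial piece of the ray is connected and off the diagram, so membership is constant
  along it and one height \<open>e\<close> decides.\<close>

lemma germ_in_iff:
  assumes R: "R \<in> regions D" and U: "\<And>e. 0 < e \<Longrightarrow> e < r \<Longrightarrow> sgn (p + e *\<^sub>R d) \<in> complement D"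
    and e: "0 < e" "e < r"
  shows "germ_in p d R \<longleftrightarrow> sgn (p + e *\<^sub>R d) \<in> R"
proof -
  have *: "sgn (p + e' *\<^sub>R d) \<in> R \<longleftrightarrow> sgn (p + e *\<^sub>R d) \<in> R" if "0 < e'" "e' < r" for e'
    by (rule region_connected_family[OF R, where P = "{0<..<r}"])
      (use U e that in \<open>auto intro!: continuous_intros\<close>)
  have ev: "\<forall>\<^sub>F e' in at_right 0. 0 < e' \<and> e' < r"
    using e by (auto simp: eventually_at_right_field intro!: exI[of _ r])
  show ?thesis
  proof
    assume "germ_in p d R"
    then have "\<forall>\<^sub>F e' in at_right (0::real). sgn (p + e *\<^sub>R d) \<in> R"
      unfolding germ_in_def by (rule eventually_elim2[OF ev]) (use * in blast)
    then show "sgn (p + e *\<^sub>R d) \<in> R" by (simp add: eventually_const)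
  next
    assume "sgn (p + e *\<^sub>R d) \<in> R"
    with ev show "germ_in p d R"
      unfolding germ_in_def by (auto elim!: eventually_mono simp: *)
  qed
qed

section \<open>Periodic curves, their tangents, and points close to them\<close>

locale link =
  fixes D :: diagram
  assumes link_diagram: "link_diagram D"
begin

abbreviation "tangent i t \<equiv> vector_derivative (curve D i) (at t)"

lemma
  assumes "i < ncomps D"
  shows C1: "curve D i C1_differentiable_on UNIV"
    and norm_curve: "norm (curve D i t) = 1"
    and period1: "curve D i (t + 1) = curve D i t"
    and tangent_nonzero: "tangent i t \<noteq> 0"
  using link_diagram assms unfolding link_diagram_def by auto

lemma curve_has_derivative:
  assumes "i < ncomps D"
  shows "(curve D i has_vector_derivative tangent i t) (at t)"
  using C1[OF assms] by (simp add: C1_differentiable_on_eq vector_derivative_works)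

lemma continuous_curve: "i < ncomps D \<Longrightarrow> isCont (curve D i) t"
  using curve_has_derivative has_vector_derivative_continuous by blast

lemma continuous_on_curve:
  assumes "i < ncomps D" "continuous_on S f"
  shows "continuous_on S (\<lambda>x. curve D i (f x))"
  by (rule continuous_on_compose2[of UNIV "curve D i"])
    (use assms continuous_curve in \<open>auto intro: continuous_at_imp_continuous_on\<close>)

lemma continuous_on_tangent: "i < ncomps D \<Longrightarrow> continuous_on UNIV (\<lambda>t. tangent i t)"
  using C1 by (simp add: C1_differentiable_on_eq)

lemma period:
  assumes "i < ncomps D"
  shows "curve D i (t + of_int k) = curve D i t"
proof (induction k rule: int_induct[where k = 0])
  case (step1 k) then show ?case using period1[OF assms, of "t + of_int k"] by (simp add: add.assoc)
next
  case (step2 k) then show ?case using period1[OF assms, of "t + of_int (k - 1)"] by (simp add: add.assoc)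
qed simp

lemma curve_frac: "i < ncomps D \<Longrightarrow> curve D i (frac t) = curve D i t"
  using period[of i t "- \<lfloor>t\<rfloor>"] by (simp add: frac_def)

lemma tangent_period:
  assumes i: "i < ncomps D"
  shows "tangent i (t + of_int k) = tangent i t"
proof (rule vector_derivative_at)
  have "((curve D i \<circ> (\<lambda>s. s + - of_int k)) has_vector_derivative 1 *\<^sub>R tangent i t) (at (t + of_int k))"
    by (rule vector_diff_chain_at)
      (use curve_has_derivative[OF i, of t] in \<open>auto intro!: derivative_eq_intros\<close>)
  moreover have "curve D i (s + - of_int k) = curve D i s" for s
    using period[OF i, of s "- k"] by simp
  ultimately show "(curve D i has_vector_derivative tangent i t) (at (t + of_int k))"
    by (simp add: o_def)
qed

lemma vel_frac: "i < ncomps D \<Longrightarrow> vel D (i, frac t) = tangent i t"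
  using tangent_period[of i t "- \<lfloor>t\<rfloor>"] by (simp add: vel_def frac_def)

lemma pos_frac: "i < ncomps D \<Longrightarrow> pos D (i, frac t) = curve D i t"
  by (simp add: pos_def curve_frac)

lemma tangent_orthogonal:
  assumes i: "i < ncomps D"
  shows "curve D i t \<bullet> tangent i t = 0"
proof -
  have "((\<lambda>t. curve D i t \<bullet> curve D i t) has_vector_derivative
      curve D i t \<bullet> tangent i t + tangent i t \<bullet> curve D i t) (at t)"
    by (rule bounded_bilinear.has_vector_derivative[OF bounded_bilinear_inner
        curve_has_derivative[OF i] curve_has_derivative[OF i]])
  moreover have "(\<lambda>t. curve D i t \<bullet> curve D i t) = (\<lambda>t. 1)"
    using norm_curve[OF i] by (simp add: dot_square_norm)
  ultimately have "((\<lambda>t. 1::real) has_vector_derivative 2 * (curve D i t \<bullet> tangent i t)) (at t)"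
    by (simp add: inner_commute)
  then have "2 * (curve D i t \<bullet> tangent i t) = 0"
    using vector_derivative_at[of "\<lambda>t. 1::real"] has_vector_derivative_const
    by (metis vector_derivative_const_at)
  then show ?thesis by simp
qed

text \<open>By the double cross product formula the value is the squared speed. Position cross
  velocity is thus a continuous field of left normals, along which germs will be
  transported.\<close>

lemma orient_normal:
  assumes i: "i < ncomps D"
  shows "orient (curve D i t) (tangent i t) (cross3 (curve D i t) (tangent i t)) > 0"
proof -
  let ?p = "curve D i t" and ?u = "tangent i t"
  have "cross3 ?u (cross3 ?p ?u) = (?u \<bullet> ?u) *\<^sub>R ?p"
    using tangent_orthogonal[OF i, of t] by (simp add: Lagrange inner_commute)
  then have "orient ?p ?u (cross3 ?p ?u) = ?u \<bullet> ?u"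
    using norm_curve[OF i, of t] by (simp add: orient_def dot_square_norm)
  then show ?thesis using tangent_nonzero[OF i, of t] by simp
qed

text \<open>Compactness: parameters in the unit interval at distance at least \<open>e\<close> from
  all preimages of \<open>p\<close> have a compact image missing \<open>p\<close>, hence at positive
  distance from it. Periodicity extends this to all parameters.\<close>

lemma near_preimage:
  assumes "e > 0"
  shows "\<exists>d>0. \<forall>j < ncomps D. \<forall>y. dist (curve D j y) p < d \<longrightarrow>
    (\<exists>y'. curve D j y' = p \<and> dist y y' < e)"
proof -
  \<comment> \<open>The removed balls surround all real preimages, so one lying just across the base
    point also counts as close.\<close>
  define K where "K j = {0..1} \<inter> (\<Inter>y' \<in> {y'. curve D j y' = p}. - ball y' e)" for j
  have "compact (K j)" for j
    unfolding K_def by (intro compact_Int_closed closed_INT ballI) auto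
  then have "compact (curve D j ` K j)" if "j < ncomps D" for j
    using that by (intro compact_continuous_image continuous_on_curve) (auto intro: continuous_intros)
  then have "closed (\<Union>j < ncomps D. curve D j ` K j)"
    by (intro closed_UN) (auto intro: compact_imp_closed)
  moreover have "p \<notin> (\<Union>j < ncomps D. curve D j ` K j)"
  proof
    assume "p \<in> (\<Union>j < ncomps D. curve D j ` K j)"
    then obtain j x where "x \<in> K j" "curve D j x = p" by blast
    then have "x \<in> - ball x e" unfolding K_def by blast
    with assms show False by simp
  qed
  ultimately obtain d where d: "d > 0" "ball p d \<subseteq> - (\<Union>j < ncomps D. curve D j ` K j)"
    by (meson ComplI open_Compl open_contains_ball)
  have "\<exists>y'. curve D j y' = p \<and> dist y y' < e" if j: "j < ncomps D" and y: "dist (curve D j y) p < d" for j y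
  proof -
    have "curve D j (frac y) \<in> ball p d"
      using y by (simp add: curve_frac j dist_commute)
    then have "frac y \<notin> K j" using d(2) j by blast
    moreover have "frac y \<in> {0..1}" by (simp add: frac_lt_1 less_imp_le)
    ultimately obtain y' where y': "curve D j y' = p" "dist (frac y) y' < e"
      unfolding K_def by (auto simp: dist_commute)
    have "curve D j (y' + of_int \<lfloor>y\<rfloor>) = p" using period[OF j] y' by simp
    moreover have "dist y (y' + of_int \<lfloor>y\<rfloor>) < e"
      using y'(2) by (simp add: dist_real_def frac_def algebra_simps)
    ultimately show ?thesis by blast
  qed
  with d(1) show ?thesis by blast
qed

text \<open>To show that a point near \<open>p\<close> projects into the complement it thus suffices
  to exclude the short branches of the curves through \<open>p\<close>.\<close>

lemma near_complement:
  assumes "e > 0" "norm p = 1"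
  shows "\<exists>d>0. \<forall>x. dist x p < d \<longrightarrow> sgn x \<in> complement D \<or>
    (\<exists>j < ncomps D. \<exists>y y'. curve D j y' = p \<and> dist y y' < e \<and> sgn x = curve D j y)"
proof -
  obtain d where d: "d > 0" "\<And>j y. j < ncomps D \<Longrightarrow> dist (curve D j y) p < d \<Longrightarrow>
      \<exists>y'. curve D j y' = p \<and> dist y y' < e"
    using near_preimage[OF assms(1), of p] by auto
  have "p \<noteq> 0" using assms(2) by auto
  then have "isCont sgn p" by (intro continuous_intros) auto
  moreover have "sgn p = p" using assms(2) by (simp add: sgn_div_norm)
  ultimately obtain d' where d': "d' > 0" "\<And>x. dist x p < d' \<Longrightarrow> dist (sgn x) p < d"
    using d(1) unfolding continuous_at_eps_delta by metis
  \<comment> \<open>The bound 1 keeps \<open>x\<close> away from 0, as \<open>p\<close> has norm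
    1.\<close>
  have "sgn x \<in> complement D \<or> (\<exists>j < ncomps D. \<exists>y y'. curve D j y' = p \<and> dist y y' < e \<and> sgn x = curve D j y)"
    if x: "dist x p < min d' 1" for x
  proof -
    have "x \<noteq> 0" using x assms(2) by (auto simp: dist_norm)
    then have "sgn x \<in> sphere 0 1" by (simp add: norm_sgn)
    moreover have "\<exists>y'. curve D j y' = p \<and> dist y y' < e" if "j < ncomps D" "sgn x = curve D j y" for j y
      using d(2)[of j y] d'(2)[of x] x that by auto
    ultimately show ?thesis unfolding complement_def by blast
  qed
  with d'(1) show ?thesis by (intro exI[of _ "min d' 1"]) auto
qed

end

section \<open>Germs of regions along a segment\<close>

lemma orient_linear_right:
  "orient p u (d + d') = orient p u d + orient p u d'" "orient p u (c *\<^sub>R d) = c * orient p u d"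
  "orient p u u = 0"
  by (simp_all add: orient_def cross_add_right cross_mult_right inner_add_right)

text \<open>The sign \<open>r\<close> selects a half of the curve at \<open>t\<close>: forward and
  backward secants are handled alike, with step \<open>x\<close> positive in both cases.\<close>

lemma one_sided_slope:
  fixes g :: "real \<Rightarrow> 'a::euclidean_space"
  assumes "(g has_vector_derivative u) (at t)" "\<bar>r\<bar> = 1" "e > 0"
  shows "\<exists>d>0. \<forall>x. 0 < x \<and> x < d \<longrightarrow> dist ((g (t + r * x) - g t) /\<^sub>R x) (r *\<^sub>R u) < e"
proof -
  from assms(1,3) obtain d where d: "d > 0" "\<And>y. norm (y - t) < d \<Longrightarrow>
      norm (g y - g t - (y - t) *\<^sub>R u) \<le> e / 2 * norm (y - t)"
    unfolding has_vector_derivative_def has_derivative_at_alt by (metis half_gt_zero)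
  have "dist ((g (t + r * x) - g t) /\<^sub>R x) (r *\<^sub>R u) < e" if "0 < x" "x < d" for x
  proof -
    have "x * dist ((g (t + r * x) - g t) /\<^sub>R x) (r *\<^sub>R u)
        = norm (x *\<^sub>R ((g (t + r * x) - g t) /\<^sub>R x - r *\<^sub>R u))"
      using that(1) by (simp add: dist_norm)
    also have "\<dots> = norm (g (t + r * x) - g t - (r * x) *\<^sub>R u)"
      using that(1) by (simp add: scaleR_diff_right mult.commute)
    also have "\<dots> \<le> e / 2 * x"
      using d(2)[of "t + r * x"] that assms(2) by (simp add: abs_mult)
    also have "\<dots> < x * e" using that(1) assms(3) by simp
    finally show ?thesis using that(1) by simp
  qed
  with d(1) show ?thesis by blast
qed

context link
begin

section \<open>Double points, and germs at points that are not crossings\<close>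

lemma double_pairs_sym: "(v, w) \<in> double_pairs D \<Longrightarrow> (w, v) \<in> double_pairs D"
  by (auto simp: double_pairs_def)

lemma partner_unique: "(v, w) \<in> double_pairs D \<Longrightarrow> (v, x) \<in> double_pairs D \<Longrightarrow> w = x"
  using link_diagram unfolding link_diagram_def by blast

lemma orient_crossing: "(v, w) \<in> double_pairs D \<Longrightarrow> orient (pos D v) (vel D v) (vel D w) \<noteq> 0"
  using link_diagram unfolding link_diagram_def by blast

text \<open>At a double point \<open>orient\<close> is nonzero and changes sign when the strands are
  exchanged, so one order of each double pair is a crossing.\<close>

lemma visits_iff: "v \<in> visits D \<longleftrightarrow> (\<exists>w. (v, w) \<in> double_pairs D)"
proof
  assume "v \<in> visits D"
  then show "\<exists>w. (v, w) \<in> double_pairs D"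
    unfolding visits_def crossings_def using double_pairs_sym by fastforce
next
  assume "\<exists>w. (v, w) \<in> double_pairs D"
  then obtain w where w: "(v, w) \<in> double_pairs D" ..
  then have "pos D w = pos D v" by (auto simp: double_pairs_def)
  then have "(v, w) \<in> crossings D \<or> (w, v) \<in> crossings D"
    using w double_pairs_sym[OF w] orient_crossing[OF w] orient_skew[of "pos D v" "vel D v" "vel D w"]
    by (auto simp: crossings_def)
  then show "v \<in> visits D" by (force simp: visits_def)
qed

lemma noncrossing_preimage:
  assumes i: "i < ncomps D" and nc: "\<not> crossing_param D i t"
    and j: "j < ncomps D" and eq: "curve D j y = curve D i t"
  shows "j = i \<and> (\<exists>k. y = t + of_int k)"
proof -
  have "pos D (j, frac y) = pos D (i, frac t)"
    using i j eq by (simp add: pos_frac)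
  moreover have "((i, frac t), (j, frac y)) \<notin> double_pairs D"
    using nc by (auto simp: crossing_param_def visits_iff)
  ultimately have "j = i" "frac y = frac t"
    using i j by (auto simp: double_pairs_def points_def frac_lt_1)
  moreover from this have "y = t + of_int (\<lfloor>y\<rfloor> - \<lfloor>t\<rfloor>)"
    by (simp add: frac_def algebra_simps)
  ultimately show ?thesis by blast
qed

text \<open>By \<open>near_complement\<close> a push-off could only hit a branch through the base
  point. Away from crossings these are integer translates of one branch, which transversality
  excludes.\<close>

lemma noncrossing_complement:
  assumes i: "i < ncomps D" and nc: "\<not> crossing_param D i t"
    and tr: "orient (curve D i t) (tangent i t) d \<noteq> 0"
  shows "\<exists>r>0. \<forall>t' d' e. dist t' t < r \<and> dist d' d < r \<and> 0 < e \<and> e < r \<longrightarrow>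
    sgn (curve D i t' + e *\<^sub>R d') \<in> complement D"
proof -
  obtain r1 where r1: "r1 > 0" "\<And>x y d' e. dist x t < r1 \<Longrightarrow> dist y t < r1 \<Longrightarrow> dist d' d < r1 \<Longrightarrow> e \<noteq> 0 \<Longrightarrow>
      sgn (curve D i x + e *\<^sub>R d') \<noteq> curve D i y"
    using transversal_pushoff_avoids_curve[OF C1[OF i] tr] by metis
  obtain r2 where r2: "r2 > 0" "\<And>x. dist x (curve D i t) < r2 \<Longrightarrow> sgn x \<in> complement D \<or>
    (\<exists>j < ncomps D. \<exists>y y'. curve D j y' = curve D i t \<and> dist y y' < r1 \<and> sgn x = curve D j y)"
    using near_complement[OF r1(1) norm_curve[OF i]] by metis
  obtain r3 where r3: "r3 > 0" "\<And>x. dist x t < r3 \<Longrightarrow> dist (curve D i x) (curve D i t) < r2 / 2"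
    using continuous_curve[OF i, of t] r2(1) unfolding continuous_at_eps_delta by (meson half_gt_zero)
  \<comment> \<open>Base point and push are each to stay within \<open>r2 / 2\<close> of their
    limits; the entry 1 gives \<open>norm d' \<le> norm d + 1\<close>.\<close>
  define r where "r = Min {r1, r3, 1, r2 / (2 * (norm d + 1))}"
  have r: "r > 0" "r \<le> r1" "r \<le> r3" "r \<le> 1" "r \<le> r2 / (2 * (norm d + 1))"
    using r1(1) r2(1) r3(1) by (auto simp: r_def add_nonneg_pos)
  have "sgn (curve D i t' + e *\<^sub>R d') \<in> complement D"
    if t': "dist t' t < r" and d': "dist d' d < r" and e: "0 < e" "e < r" for t' d' e
  proof -
    let ?x = "curve D i t' + e *\<^sub>R d'"
    have nd: "norm d' \<le> norm d + 1"
      using d' r(4) norm_triangle_ineq2[of d' d] by (simp add: dist_norm)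
    have "norm (e *\<^sub>R d') \<le> e * (norm d + 1)"
      using e nd by (simp add: mult_left_mono)
    also have "\<dots> \<le> r2 / (2 * (norm d + 1)) * (norm d + 1)"
      using e r(5) by (intro mult_right_mono) auto
    also have "\<dots> = r2 / 2"
      using norm_ge_zero[of d] by (simp add: field_simps add_nonneg_eq_0_iff)
    finally have "norm (e *\<^sub>R d') \<le> r2 / 2" .
    moreover have "dist (curve D i t') (curve D i t) < r2 / 2"
      using r3(2) t' r(3) by simp
    moreover have "dist ?x (curve D i t) \<le> norm (e *\<^sub>R d') + dist (curve D i t') (curve D i t)"
      using norm_triangle_ineq[of "e *\<^sub>R d'" "curve D i t' - curve D i t"]
      by (simp add: dist_norm algebra_simps)
    ultimately have *: "dist ?x (curve D i t) < r2" by linarith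
    show ?thesis
    proof (rule ccontr)
      assume "sgn ?x \<notin> complement D"
      with r2(2)[OF *] obtain j y y' where j: "j < ncomps D" "curve D j y' = curve D i t"
        and y: "dist y y' < r1" "sgn ?x = curve D j y" by blast
      \<comment> \<open>Shifting \<open>y\<close> by this integer brings it close to
        \<open>t\<close> without changing the point hit.\<close>
      from noncrossing_preimage[OF i nc j] obtain k where k: "j = i" "y' = t + of_int k" by blast
      have "curve D i (y - of_int k) = curve D j y"
        using period[OF i, of y "- k"] k(1) by simp
      moreover have "dist (y - of_int k) t < r1"
        using y(1) k(2) by (simp add: dist_real_def algebra_simps)
      ultimately show False
        using r1(2)[of t' "y - of_int k" d' e] t' d' e r(2) y(2) by simp
    qed
  qed
  with r(1) show ?thesis by blast
qed

text \<open>At the common height \<open>r / 2\<close> the push-offs over a product of two balls form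
  a connected family in the complement, and every germ can be read off at that height.\<close>

lemma germ_in_locally_constant:
  assumes i: "i < ncomps D" and nc: "\<not> crossing_param D i t"
    and tr: "orient (curve D i t) (tangent i t) d \<noteq> 0"
  shows "\<exists>r>0. \<forall>t' d' R. dist t' t < r \<and> dist d' d < r \<and> R \<in> regions D \<longrightarrow>
    (germ_in (curve D i t') d' R \<longleftrightarrow> germ_in (curve D i t) d R)"
proof -
  obtain r where r: "r > 0" "\<And>t' d' e. dist t' t < r \<Longrightarrow> dist d' d < r \<Longrightarrow> 0 < e \<Longrightarrow> e < r \<Longrightarrow>
      sgn (curve D i t' + e *\<^sub>R d') \<in> complement D"
    using noncrossing_complement[OF assms] by blast
  have "germ_in (curve D i t') d' R \<longleftrightarrow> germ_in (curve D i t) d R"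
    if t': "dist t' t < r" and d': "dist d' d < r" and R: "R \<in> regions D" for t' d' R
  proof -
    have "connected (ball t r \<times> ball d r)"
      by (intro convex_connected convex_Times convex_ball)
    moreover have "continuous_on (ball t r \<times> ball d r) (\<lambda>z. curve D i (fst z) + (r/2) *\<^sub>R snd z)"
      by (intro continuous_intros continuous_on_curve[OF i])
    ultimately have "sgn (curve D i t' + (r/2) *\<^sub>R d') \<in> R \<longleftrightarrow> sgn (curve D i t + (r/2) *\<^sub>R d) \<in> R"
      using region_connected_family[OF R, of "ball t r \<times> ball d r"
          "\<lambda>z. curve D i (fst z) + (r/2) *\<^sub>R snd z" "(t', d')" "(t, d)"] r t' d'
      by (simp add: dist_commute mem_Times_iff)
    moreover have "germ_in (curve D i t') d' R \<longleftrightarrow> sgn (curve D i t' + (r/2) *\<^sub>R d') \<in> R"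
      by (rule germ_in_iff[OF R, of r]) (use r t' d' in auto)
    moreover have "germ_in (curve D i t) d R \<longleftrightarrow> sgn (curve D i t + (r/2) *\<^sub>R d) \<in> R"
      by (rule germ_in_iff[OF R, of r]) (use r in auto)
    ultimately show ?thesis by simp
  qed
  with r(1) show ?thesis by blast
qed

text \<open>Directions on one side of the tangent form a half-space, which is convex and hence
  connected, and the germ is locally constant on it. The sign of \<open>c\<close> selects the
  side.\<close>

lemma germ_in_same_side:
  assumes i: "i < ncomps D" and nc: "\<not> crossing_param D i t" and R: "R \<in> regions D"
    and "c * orient (curve D i t) (tangent i t) d > 0" "c * orient (curve D i t) (tangent i t) d' > 0"
  shows "germ_in (curve D i t) d R \<longleftrightarrow> germ_in (curve D i t) d' R"
proof -
  define f where "f x = c * orient (curve D i t) (tangent i t) x" for x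
  have f: "f (a *\<^sub>R x + b *\<^sub>R y) = a * f x + b * f y" for a b x y
    by (simp add: f_def orient_linear_right distrib_left mult.left_commute)
  have "convex {x. f x > 0}"
  proof (rule convexI)
    fix x y and a b :: real
    assume "x \<in> {x. f x > 0}" "y \<in> {x. f x > 0}" and ab: "0 \<le> a" "0 \<le> b" "a + b = 1"
    then have "a * - f x + b * - f y < 0"
      by (intro convex_bound_lt) auto
    then show "a *\<^sub>R x + b *\<^sub>R y \<in> {x. f x > 0}"
      by (simp add: f)
  qed
  then have "connected {x. f x > 0}" by (rule convex_connected)
  moreover have "d \<in> {x. f x > 0}" "d' \<in> {x. f x > 0}"
    using assms(4,5) by (simp_all add: f_def)
  moreover have "\<forall>x\<in>{x. f x > 0}. eventually (\<lambda>y. germ_in (curve D i t) x R = germ_in (curve D i t) y R) (at x within {x. f x > 0})"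
  proof
    fix x assume "x \<in> {x. f x > 0}"
    then have "orient (curve D i t) (tangent i t) x \<noteq> 0" by (auto simp: f_def)
    from germ_in_locally_constant[OF i nc this] obtain r where
      r: "r > 0" "\<forall>t' d' R. dist t' t < r \<and> dist d' x < r \<and> R \<in> regions D \<longrightarrow>
        (germ_in (curve D i t') d' R \<longleftrightarrow> germ_in (curve D i t) x R)" by (elim exE conjE)
    have "germ_in (curve D i t) x R = germ_in (curve D i t) y R" if "dist y x < r" for y
      using r(2)[rule_format, of t y R] r(1) that R by simp
    then show "eventually (\<lambda>y. germ_in (curve D i t) x R = germ_in (curve D i t) y R) (at x within {x. f x > 0})"
      unfolding eventually_at using r(1) by (intro exI[of _ r]) simp
  qed
  ultimately show ?thesis
    by (rule connected_local_const)
qed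

text \<open>The germ in the normal direction \<open>n\<close> is locally constant between crossings,
  hence constant. At both ends the direction is then changed within its half-space.\<close>

lemma germ_in_along_segment:
  assumes i: "i < ncomps D" and nc: "\<And>r. s < r \<Longrightarrow> r < t \<Longrightarrow> \<not> crossing_param D i r" and R: "R \<in> regions D"
    and xy: "s < x" "x < t" "s < y" "y < t"
    and side: "c * orient (curve D i x) (tangent i x) d > 0" "c * orient (curve D i y) (tangent i y) d' > 0"
  shows "germ_in (curve D i x) d R \<longleftrightarrow> germ_in (curve D i y) d' R"
proof -
  have c: "c \<noteq> 0" using side(1) by auto
  define n where "n z = c *\<^sub>R cross3 (curve D i z) (tangent i z)" for z
  have n: "c * orient (curve D i z) (tangent i z) (n z) > 0" for z
    using orient_normal[OF i, of z] c
    by (simp add: n_def orient_linear_right mult.assoc[symmetric] zero_less_mult_iff) (auto simp: linorder_neq_iff)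
  have cont: "isCont n z" for z
    using continuous_on_tangent[OF i] continuous_curve[OF i] unfolding n_def
    by (intro continuous_intros continuous_cross) (auto simp: continuous_on_eq_continuous_at)
  have "germ_in (curve D i x) (n x) R \<longleftrightarrow> germ_in (curve D i y) (n y) R"
  proof (rule connected_local_const[of "{s<..<t}"])
    show "\<forall>z\<in>{s<..<t}. eventually (\<lambda>y. germ_in (curve D i z) (n z) R = germ_in (curve D i y) (n y) R) (at z within {s<..<t})"
    proof
      fix z assume "z \<in> {s<..<t}"
      then have "\<not> crossing_param D i z" using nc by auto
      moreover have "orient (curve D i z) (tangent i z) (n z) \<noteq> 0" using n[of z] by auto
      ultimately have "\<exists>r>0. \<forall>t' d' R. dist t' z < r \<and> dist d' (n z) < r \<and> R \<in> regions D \<longrightarrow>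
          (germ_in (curve D i t') d' R \<longleftrightarrow> germ_in (curve D i z) (n z) R)"
        by (rule germ_in_locally_constant[OF i])
      then obtain r where r: "r > 0" "\<forall>t' d' R. dist t' z < r \<and> dist d' (n z) < r \<and> R \<in> regions D \<longrightarrow>
          (germ_in (curve D i t') d' R \<longleftrightarrow> germ_in (curve D i z) (n z) R)" by (elim exE conjE)
      obtain r' where r': "r' > 0" "\<And>y. dist y z < r' \<Longrightarrow> dist (n y) (n z) < r"
        using cont[of z] r(1) unfolding continuous_at_eps_delta by blast
      have "germ_in (curve D i z) (n z) R = germ_in (curve D i y) (n y) R" if "dist y z < min r r'" for y
        using r(2)[rule_format, of y "n y" R] r'(2)[of y] that R by simp
      then show "eventually (\<lambda>y. germ_in (curve D i z) (n z) R = germ_in (curve D i y) (n y) R) (at z within {s<..<t})"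
        unfolding eventually_at using r(1) r'(1) by (intro exI[of _ "min r r'"]) simp
    qed
  qed (use xy in auto)
  moreover have "germ_in (curve D i x) d R \<longleftrightarrow> germ_in (curve D i x) (n x) R"
    by (rule germ_in_same_side[OF i _ R side(1) n]) (use nc xy in auto)
  moreover have "germ_in (curve D i y) d' R \<longleftrightarrow> germ_in (curve D i y) (n y) R"
    by (rule germ_in_same_side[OF i _ R side(2) n]) (use nc xy in auto)
  ultimately show ?thesis by simp
qed

section \<open>Corners at a crossing and the segments bounding them\<close>

lemma crossing_preimage:
  assumes "(v, w) \<in> double_pairs D" "j < ncomps D" "curve D j y = pos D v"
  shows "(j, frac y) = v \<or> (j, frac y) = w"
proof (rule ccontr)
  assume *: "\<not> ?thesis"
  with assms have "(v, (j, frac y)) \<in> double_pairs D"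
    by (auto simp: double_pairs_def points_def pos_frac frac_lt_1)
  with partner_unique[OF assms(1)] * show False by blast
qed

text \<open>Partners are unique, so the preimages of the crossing point are translates of
  \<open>s\<close> and \<open>t\<close>, and no third branch comes near.\<close>

lemma crossing_complement:
  assumes i: "i < ncomps D" and j: "j < ncomps D"
    and dp: "((i, frac s), (j, frac t)) \<in> double_pairs D" and "e > 0"
  shows "\<exists>r>0. \<forall>x. dist x (curve D i s) < r \<longrightarrow> sgn x \<in> complement D \<or>
    (\<exists>y. dist y s < e \<and> sgn x = curve D i y) \<or> (\<exists>y. dist y t < e \<and> sgn x = curve D j y)"
proof -
  obtain r where r: "r > 0" "\<And>x. dist x (curve D i s) < r \<Longrightarrow> sgn x \<in> complement D \<or>
    (\<exists>j < ncomps D. \<exists>y y'. curve D j y' = curve D i s \<and> dist y y' < e \<and> sgn x = curve D j y)"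
    using near_complement[OF \<open>e > 0\<close> norm_curve[OF i]] by metis
  \<comment> \<open>Replaces a parameter near an integer translate of \<open>y0\<close> by one near
    \<open>y0\<close> with the same image.\<close>
  have shift: "\<exists>z. dist z y0 < e \<and> curve D k y = curve D k z"
    if "k < ncomps D" "frac y' = frac y0" "dist y y' < e" for k y y' y0
  proof (intro exI conjI)
    let ?n = "\<lfloor>y0\<rfloor> - \<lfloor>y'\<rfloor>"
    show "curve D k y = curve D k (y + of_int ?n)" using period[OF that(1), of y ?n] by simp
    show "dist (y + of_int ?n) y0 < e"
      using that(2,3) by (simp add: dist_real_def frac_def algebra_simps)
  qed
  have "(\<exists>y. dist y s < e \<and> sgn x = curve D i y) \<or> (\<exists>y. dist y t < e \<and> sgn x = curve D j y)"
    if x: "dist x (curve D i s) < r" "sgn x \<notin> complement D" for x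
  proof -
    obtain k y y' where k: "k < ncomps D" "curve D k y' = curve D i s" "dist y y' < e" "sgn x = curve D k y"
      using r(2)[OF x(1)] x(2) by blast
    from crossing_preimage[OF dp k(1)] k(2) have "(k, frac y') = (i, frac s) \<or> (k, frac y') = (j, frac t)"
      by (simp add: pos_frac i)
    then show ?thesis using shift[OF k(1) _ k(3)] k(4) by auto
  qed
  with r(1) show ?thesis by blast
qed


text \<open>The straight ray into a corner is deformed, off both strands, to a point pushed slightly
  off strand \<open>i\<close>. The signs \<open>\<rho>\<close> and \<open>\<kappa>\<close> choose
  the halves of the two strands that bound the corner, so one statement covers all four
  corners.\<close>

lemma corner_germ:
  assumes i: "i < ncomps D" and j: "j < ncomps D"
    and dp: "((i, frac s), (j, frac t)) \<in> double_pairs D"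
    and rk: "\<bar>\<rho>\<bar> = 1" "\<bar>\<kappa>\<bar> = 1"
  shows "\<exists>r>0. \<forall>a R. 0 < a \<and> a < r \<and> \<not> crossing_param D i (s + \<rho> * a) \<and> R \<in> regions D \<longrightarrow>
    (germ_in (curve D i s) (\<rho> *\<^sub>R tangent i s + \<kappa> *\<^sub>R tangent j t) R \<longleftrightarrow>
     germ_in (curve D i (s + \<rho> * a)) (\<kappa> *\<^sub>R tangent j t) R)"
proof -
  define p where "p = curve D i s"
  define u where "u = \<rho> *\<^sub>R tangent i s"
  define w where "w = \<kappa> *\<^sub>R tangent j t"
  \<comment> \<open>Secant slopes at the crossing, close to \<open>u\<close> and \<open>w\<close>.
    They express each strand as \<open>p\<close> plus a small multiple of a controlled
    vector.\<close>
  define A where "A a = (curve D i (s + \<rho> * a) - p) /\<^sub>R a" for a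
  define B where "B b = (curve D j (t + \<kappa> * b) - p) /\<^sub>R b" for b
  have p: "curve D i s = p" "curve D j t = p"
    using dp i j by (simp_all add: p_def double_pairs_def pos_frac)
  have A: "curve D i (s + \<rho> * a) = p + a *\<^sub>R A a" if "a \<noteq> 0" for a
    using that by (simp add: A_def)
  have B: "curve D j (t + \<kappa> * b) = p + b *\<^sub>R B b" if "b \<noteq> 0" for b
    using that by (simp add: B_def)
  have nz: "\<rho> \<noteq> 0" "\<kappa> \<noteq> 0" using rk by auto
  have "orient p (tangent i s) (tangent j t) \<noteq> 0"
    using orient_crossing[OF dp] i j by (simp add: pos_frac vel_frac p)
  \<comment> \<open>The first two facts serve the surface \<open>G\<close>, the last two the
    deformation \<open>F\<close> of the corner ray.\<close>
  then have tr: "orient p (tangent i s) w \<noteq> 0" "orient p (tangent j t) u \<noteq> 0"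
      "orient p (tangent i s) (u + w) \<noteq> 0" "orient p (tangent j t) (u + w) \<noteq> 0"
    using nz orient_skew[of p "tangent i s" "tangent j t"]
    by (simp_all add: u_def w_def orient_linear_right)
  obtain r1 where r1: "r1 > 0" "\<And>x y d e. dist x s < r1 \<Longrightarrow> dist y s < r1 \<Longrightarrow> dist d w < r1 \<Longrightarrow> e \<noteq> 0 \<Longrightarrow>
      sgn (curve D i x + e *\<^sub>R d) \<noteq> curve D i y"
    using transversal_pushoff_avoids_curve[OF C1[OF i], of s w] tr(1) unfolding p by metis
  obtain r2 where r2: "r2 > 0" "\<And>x y d e. dist x t < r2 \<Longrightarrow> dist y t < r2 \<Longrightarrow> dist d u < r2 \<Longrightarrow> e \<noteq> 0 \<Longrightarrow>
      sgn (curve D j x + e *\<^sub>R d) \<noteq> curve D j y"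
    using transversal_pushoff_avoids_curve[OF C1[OF j], of t u] tr(2) unfolding p by metis
  obtain r3 where r3: "r3 > 0" "\<And>x y d e. dist x s < r3 \<Longrightarrow> dist y s < r3 \<Longrightarrow> dist d (u + w) < r3 \<Longrightarrow> e \<noteq> 0 \<Longrightarrow>
      sgn (curve D i x + e *\<^sub>R d) \<noteq> curve D i y"
    using transversal_pushoff_avoids_curve[OF C1[OF i], of s "u + w"] tr(3) unfolding p by metis
  obtain r4 where r4: "r4 > 0" "\<And>x y d e. dist x t < r4 \<Longrightarrow> dist y t < r4 \<Longrightarrow> dist d (u + w) < r4 \<Longrightarrow> e \<noteq> 0 \<Longrightarrow>
      sgn (curve D j x + e *\<^sub>R d) \<noteq> curve D j y"
    using transversal_pushoff_avoids_curve[OF C1[OF j], of t "u + w"] tr(4) unfolding p by metis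
  define c where "c = Min {r1, r2, r3, r4, 1}"
  have c: "c > 0" "c \<le> r1" "c \<le> r2" "c \<le> r3" "c \<le> r4" "c \<le> 1"
    using r1(1) r2(1) r3(1) r4(1) by (auto simp: c_def)
  obtain r5 where r5: "r5 > 0" "\<And>x. dist x p < r5 \<Longrightarrow> sgn x \<in> complement D \<or>
      (\<exists>y. dist y s < c \<and> sgn x = curve D i y) \<or> (\<exists>y. dist y t < c \<and> sgn x = curve D j y)"
    using crossing_complement[OF i j dp c(1)] unfolding p by metis
  obtain r6 where r6: "r6 > 0" "\<And>x. 0 < x \<Longrightarrow> x < r6 \<Longrightarrow> dist (A x) u < c / 2"
    using one_sided_slope[OF curve_has_derivative[OF i] rk(1), of "c / 2" s] c(1)
    unfolding A_def u_def p_def by auto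
  obtain r7 where r7: "r7 > 0" "\<And>x. 0 < x \<Longrightarrow> x < r7 \<Longrightarrow> dist (B x) w < c / 2"
    using one_sided_slope[OF curve_has_derivative[OF j] rk(2), of "c / 2" t] c(1)
    unfolding B_def w_def p by auto
  define M where "M = norm u + norm w + 1"
  have M: "M > 0" by (simp add: M_def add_nonneg_pos)
  define r where "r = Min {r6, r7, c, r5 / (2 * M)}"
  have r: "r > 0" "r \<le> r6" "r \<le> r7" "r \<le> c" "r \<le> r5 / (2 * M)"
    using r5(1) r6(1) r7(1) c(1) M by (auto simp: r_def)
  have rM: "r * M \<le> r5 / 2" using r(5) M by (simp add: field_simps)
  have Au: "dist (A a) u < c / 2" if "0 < a" "a < r" for a
    using r6(2)[of a] that r(2) by simp
  have Bw: "dist (B b) w < c / 2" if "0 < b" "b < r" for b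
    using r7(2)[of b] that r(3) by simp
  have ds: "dist (s + \<rho> * a) s < c" "dist (t + \<kappa> * a) t < c" if "0 < a" "a < r" for a
    using rk that r(4) by (simp_all add: dist_real_def abs_mult)
  have small: "norm (e *\<^sub>R k) < r5 / 2" if "0 < e" "e < r" "norm k \<le> M" for e :: real and k :: "real^3"
  proof -
    have "norm (e *\<^sub>R k) \<le> e * M" using that by (simp add: mult_left_mono)
    also have "\<dots> < r * M" using that M by simp
    finally show ?thesis using rM by simp
  qed
  have nA: "norm (A a) \<le> M" if "0 < a" "a < r" for a
    using Au[OF that] c(6) norm_triangle_ineq2[of "A a" u] unfolding M_def dist_norm
    by (smt (verit) norm_ge_zero field_sum_of_halves)
  have nB: "norm (B b) \<le> M" if "0 < b" "b < r" for b
    using Bw[OF that] c(6) norm_triangle_ineq2[of "B b" w] unfolding M_def dist_norm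
    by (smt (verit) norm_ge_zero field_sum_of_halves)

  \<comment> \<open>\<open>G (a, b)\<close> is a push of strand \<open>i\<close> along a secant of
    strand \<open>j\<close>, and equally a push of strand \<open>j\<close> along a secant of strand
    \<open>i\<close>; hence it avoids both.\<close>
  define G where "G z = curve D i (s + \<rho> * fst z) + curve D j (t + \<kappa> * snd z) - p" for z
  have G: "sgn (G (a, b)) \<in> complement D" if a: "0 < a" "a < r" and b: "0 < b" "b < r" for a b
  proof -
    have "G (a, b) - p = a *\<^sub>R A a + b *\<^sub>R B b"
      using A[of a] B[of b] a b by (simp add: G_def)
    then have "dist (G (a, b)) p < r5"
      using small[OF a nA[OF a]] small[OF b nB[OF b]] norm_triangle_ineq[of "a *\<^sub>R A a" "b *\<^sub>R B b"]
      unfolding dist_norm by simp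
    moreover have "sgn (G (a, b)) \<noteq> curve D i y" if "dist y s < c" for y
    proof -
      have "G (a, b) = curve D i (s + \<rho> * a) + b *\<^sub>R B b"
        using B[of b] b by (simp add: G_def)
      then show ?thesis
        using r1(2)[of "s + \<rho> * a" y "B b" b] that ds(1)[OF a] Bw[OF b] b c(1,2) by simp
    qed
    moreover have "sgn (G (a, b)) \<noteq> curve D j y" if "dist y t < c" for y
    proof -
      have "G (a, b) = curve D j (t + \<kappa> * b) + a *\<^sub>R A a"
        using A[of a] a by (simp add: G_def)
      then show ?thesis
        using r2(2)[of "t + \<kappa> * b" y "A a" a] that ds(2)[OF b] Au[OF a] a c(1,3) by simp
    qed
    ultimately show ?thesis using r5(2) by blast
  qed

  \<comment> \<open>Bends the corner ray into the diagonal of \<open>G\<close>. Each stage is a push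
    of \<open>p\<close> in a direction close to \<open>u + w\<close>, which is transversal to both
    strands.\<close>
  define F where "F z = p + ((1 - fst z) * snd z) *\<^sub>R (u + w) + fst z *\<^sub>R (G (snd z, snd z) - p)" for z
  have F: "sgn (F (l, e)) \<in> complement D" if l: "0 \<le> l" "l \<le> 1" and e: "0 < e" "e < r" for l e
  proof -
    define k where "k = u + w + l *\<^sub>R ((A e - u) + (B e - w))"
    have Fk: "F (l, e) = p + e *\<^sub>R k"
      using A[of e] B[of e] e by (simp add: F_def G_def k_def algebra_simps)
    have "dist k (u + w) = l * norm ((A e - u) + (B e - w))"
      using l by (simp add: k_def dist_norm)
    also have "\<dots> \<le> norm ((A e - u) + (B e - w))"
      using l by (simp add: mult_left_le_one_le)
    also have "\<dots> < c"
      using Au[OF e] Bw[OF e] norm_triangle_ineq[of "A e - u" "B e - w"] unfolding dist_norm by linarith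
    finally have dk: "dist k (u + w) < c" .
    have "norm k \<le> norm (u + w) + dist k (u + w)"
      using norm_triangle_ineq[of "u + w" "k - (u + w)"] by (simp add: dist_norm)
    then have "norm k \<le> M"
      using dk c(6) norm_triangle_ineq[of u w] by (simp add: M_def)
    then have "dist (F (l, e)) p < r5"
      using small[OF e, of k] r5(1) by (simp add: Fk dist_norm)
    moreover have "sgn (F (l, e)) \<noteq> curve D i y" if "dist y s < c" for y
      using r3(2)[of s y k e] that dk c(1,4) e by (simp add: Fk p)
    moreover have "sgn (F (l, e)) \<noteq> curve D j y" if "dist y t < c" for y
      using r4(2)[of t y k e] that dk c(1,5) e by (simp add: Fk p)
    ultimately show ?thesis using r5(2) by blast
  qed

  have "germ_in p (u + w) R \<longleftrightarrow> germ_in (curve D i (s + \<rho> * a)) w R"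
    if a: "0 < a" "a < r" and nc: "\<not> crossing_param D i (s + \<rho> * a)" and R: "R \<in> regions D"
      and side: "orient (curve D i (s + \<rho> * a)) (tangent i (s + \<rho> * a)) w \<noteq> 0" for a R
  proof -
    let ?q = "curve D i (s + \<rho> * a)"
    obtain r8 where r8: "r8 > 0" "\<And>t' d' e. dist t' (s + \<rho> * a) < r8 \<Longrightarrow> dist d' w < r8 \<Longrightarrow> 0 < e \<Longrightarrow> e < r8 \<Longrightarrow>
        sgn (curve D i t' + e *\<^sub>R d') \<in> complement D"
      using noncrossing_complement[OF i nc side] by blast
    obtain r9 where r9: "r9 > 0" "\<And>x. 0 < x \<Longrightarrow> x < r9 \<Longrightarrow> dist (B x) w < r8"
      using one_sided_slope[OF curve_has_derivative[OF j] rk(2) r8(1), of t]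
      unfolding B_def w_def p by auto
    define r' where "r' = Min {r, r8, r9}"
    have r': "r' > 0" "r' \<le> r" "r' \<le> r8" "r' \<le> r9"
      using r(1) r8(1) r9(1) by (auto simp: r'_def)
    \<comment> \<open>The height \<open>b\<close> comes after \<open>a\<close>, because the radii
      \<open>r8\<close> and \<open>r9\<close> at \<open>?q\<close> depend on
      \<open>a\<close>.\<close>
    define b where "b = r' / 2"
    have b: "0 < b" "b < r" "b < r'" using r' by (auto simp: b_def)
    \<comment> \<open>Turns the secant \<open>B b\<close> into \<open>w\<close> above the fixed
      point \<open>?q\<close>, joining \<open>G (a, b)\<close> to a straight push-off.\<close>
    define H where "H l = ?q + b *\<^sub>R (w + l *\<^sub>R (B b - w))" for l :: real
    have H: "sgn (H l) \<in> complement D" if "0 \<le> l" "l \<le> 1" for l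
    proof -
      have "dist (w + l *\<^sub>R (B b - w)) w = l * dist (B b) w"
        using that by (simp add: dist_norm)
      also have "\<dots> \<le> dist (B b) w"
        using that by (simp add: mult_left_le_one_le)
      also have "\<dots> < r8" using r9(2)[of b] b r' by simp
      finally show ?thesis
        using r8(2)[of "s + \<rho> * a" _ b] r8(1) b r' unfolding H_def by simp
    qed
    have "germ_in p (u + w) R \<longleftrightarrow> sgn (p + b *\<^sub>R (u + w)) \<in> R"
      by (rule germ_in_iff[OF R, of r]) (use F[of 0] b in \<open>auto simp: F_def\<close>)
    also have "p + b *\<^sub>R (u + w) = F (0, b)" by (simp add: F_def)
    also have "sgn (F (0, b)) \<in> R \<longleftrightarrow> sgn (F (1, b)) \<in> R"
    proof (rule region_connected_family[OF R, where F = F and P = "{0..1} \<times> {0<..<r}"])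
      show "connected ({0..1::real} \<times> {0<..<r})"
        by (intro convex_connected convex_Times) auto
      show "continuous_on ({0..1::real} \<times> {0<..<r}) F"
        unfolding F_def G_def by (auto intro!: continuous_intros continuous_on_curve i j)
    qed (use F b in auto)
    also have "F (1, b) = G (b, b)" by (simp add: F_def)
    also have "sgn (G (b, b)) \<in> R \<longleftrightarrow> sgn (G (a, b)) \<in> R"
    proof (rule region_connected_family[OF R, where F = G and P = "{0<..<r} \<times> {0<..<r}"])
      show "connected ({0<..<r} \<times> {0<..<r})"
        by (intro convex_connected convex_Times) auto
      show "continuous_on ({0<..<r} \<times> {0<..<r}) G"
        unfolding G_def by (auto intro!: continuous_intros continuous_on_curve i j)
    qed (use G a b in auto)
    also have "G (a, b) = H 1"
      using B[of b] b by (simp add: G_def H_def)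
    also have "sgn (H 1) \<in> R \<longleftrightarrow> sgn (H 0) \<in> R"
      by (rule region_connected_family[OF R, of "{0..1}"])
        (use H in \<open>auto simp: H_def intro!: continuous_intros\<close>)
    also have "H 0 = ?q + b *\<^sub>R w" by (simp add: H_def)
    also have "sgn (?q + b *\<^sub>R w) \<in> R \<longleftrightarrow> germ_in ?q w R"
      by (rule germ_in_iff[OF R, of r8, symmetric]) (use r8 b r' in auto)
    finally show ?thesis .
  qed
  moreover obtain r0 where r0: "r0 > 0" "\<And>x. dist x s < r0 \<Longrightarrow> orient (curve D i x) (tangent i x) w \<noteq> 0"
  proof -
    have "isCont (\<lambda>x. orient (curve D i x) (tangent i x) w) s"
      using continuous_on_tangent[OF i] continuous_curve[OF i]
      by (intro continuous_intros) (auto simp: continuous_on_eq_continuous_at)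
    from continuous_at_avoid[OF this, of 0] tr(1) p that show thesis
      by (metis dist_commute)
  qed
  ultimately have "\<forall>a R. 0 < a \<and> a < min r r0 \<and> \<not> crossing_param D i (s + \<rho> * a) \<and> R \<in> regions D \<longrightarrow>
    germ_in p (u + w) R = germ_in (curve D i (s + \<rho> * a)) w R"
    using rk by (simp add: dist_real_def abs_mult)
  with r(1) r0(1) show ?thesis
    unfolding p_def u_def w_def by (intro exI[of _ "min r r0"]) simp
qed

text \<open>\<open>corner_germ\<close> is applied forwards at \<open>s\<close> and backwards at
  \<open>t\<close>, and the resulting push-offs are joined along the segment. The sign conditions
  with a common \<open>c\<close> say that both corners lie on the same side.\<close>

lemma segment_sides:
  assumes i: "i < ncomps D" and st: "s < t" and nc: "\<And>r. s < r \<Longrightarrow> r < t \<Longrightarrow> \<not> crossing_param D i r"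
    and R: "R \<in> regions D"
    and s': "j < ncomps D" "((i, frac s), (j, frac s')) \<in> double_pairs D" "\<bar>\<kappa>\<bar> = 1"
    and t': "l < ncomps D" "((i, frac t), (l, frac t')) \<in> double_pairs D" "\<bar>\<mu>\<bar> = 1"
    and side: "c * \<kappa> * orient (curve D i s) (tangent i s) (tangent j s') > 0"
      "c * \<mu> * orient (curve D i t) (tangent i t) (tangent l t') > 0"
  shows "germ_in (curve D i s) (tangent i s + \<kappa> *\<^sub>R tangent j s') R \<longleftrightarrow>
    germ_in (curve D i t) (- tangent i t + \<mu> *\<^sub>R tangent l t') R"
proof -
  have near: "\<exists>r>0. \<forall>x. dist x z < r \<longrightarrow> c * orient (curve D i x) (tangent i x) d > 0"
    if "c * orient (curve D i z) (tangent i z) d > 0" for z d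
  proof -
    define h where "h x = c * orient (curve D i x) (tangent i x) d" for x
    have "isCont h z"
      using continuous_on_tangent[OF i] continuous_curve[OF i] unfolding h_def
      by (intro continuous_intros) (auto simp: continuous_on_eq_continuous_at)
    then have "(h \<longlongrightarrow> h z) (nhds z)"
      by (simp add: isCont_def tendsto_at_iff_tendsto_nhds)
    then have "\<forall>\<^sub>F x in nhds z. 0 < h x"
      using order_tendstoD(1) that h_def by metis
    then show ?thesis by (simp add: eventually_nhds_metric h_def)
  qed
  obtain r1 where r1: "r1 > 0" "\<And>x. dist x s < r1 \<Longrightarrow> c * orient (curve D i x) (tangent i x) (\<kappa> *\<^sub>R tangent j s') > 0"
    using near[of s "\<kappa> *\<^sub>R tangent j s'"] side(1) by (auto simp: orient_linear_right mult.assoc)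
  obtain r2 where r2: "r2 > 0" "\<And>x. dist x t < r2 \<Longrightarrow> c * orient (curve D i x) (tangent i x) (\<mu> *\<^sub>R tangent l t') > 0"
    using near[of t "\<mu> *\<^sub>R tangent l t'"] side(2) by (auto simp: orient_linear_right mult.assoc)
  obtain r3 where r3: "r3 > 0" "\<forall>a R. 0 < a \<and> a < r3 \<and> \<not> crossing_param D i (s + 1 * a) \<and> R \<in> regions D \<longrightarrow>
    (germ_in (curve D i s) (1 *\<^sub>R tangent i s + \<kappa> *\<^sub>R tangent j s') R \<longleftrightarrow>
     germ_in (curve D i (s + 1 * a)) (\<kappa> *\<^sub>R tangent j s') R)"
    using corner_germ[OF i s'(1,2) abs_one s'(3)] by (elim exE conjE)
  obtain r4 where r4: "r4 > 0" "\<forall>a R. 0 < a \<and> a < r4 \<and> \<not> crossing_param D i (t + -1 * a) \<and> R \<in> regions D \<longrightarrow>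
    (germ_in (curve D i t) (-1 *\<^sub>R tangent i t + \<mu> *\<^sub>R tangent l t') R \<longleftrightarrow>
     germ_in (curve D i (t + -1 * a)) (\<mu> *\<^sub>R tangent l t') R)"
    using corner_germ[OF i t'(1,2) _ t'(3), of "-1", OF abs_neg_one] by (elim exE conjE)
  \<comment> \<open>Fits both end neighbourhoods, and is below \<open>t - s\<close> so that
    \<open>s + a\<close> and \<open>t - a\<close> are interior to the segment.\<close>
  define a where "a = Min {r1, r2, r3, r4, t - s} / 2"
  have a: "0 < a" "a < r1" "a < r2" "a < r3" "a < r4" "a < t - s"
    using r1(1) r2(1) r3(1) r4(1) st by (auto simp: a_def min_def)
  have "germ_in (curve D i s) (tangent i s + \<kappa> *\<^sub>R tangent j s') R \<longleftrightarrow>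
      germ_in (curve D i (s + a)) (\<kappa> *\<^sub>R tangent j s') R"
    using r3(2)[rule_format, of a R] a nc[of "s + a"] R by simp
  also have "\<dots> \<longleftrightarrow> germ_in (curve D i (t - a)) (\<mu> *\<^sub>R tangent l t') R"
    by (rule germ_in_along_segment[OF i nc R, where c = c])
      (use a r1(2)[of "s + a"] r2(2)[of "t - a"] in \<open>auto simp: dist_real_def\<close>)
  also have "\<dots> \<longleftrightarrow> germ_in (curve D i t) (- tangent i t + \<mu> *\<^sub>R tangent l t') R"
    using r4(2)[rule_format, of a R] a nc[of "t - a"] R by simp
  finally show ?thesis .
qed

end

section \<open>Arc equations\<close>

lemma frac_add_int: "frac (r + of_int k) = frac (r :: real)"
  by (simp add: frac_def)

context link
begin

section \<open>Crossing parameters, consecutive crossings and telescoping products\<close>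

lemma visits_component: "(i, r) \<in> visits D \<Longrightarrow> i < ncomps D"
  by (auto simp: visits_iff double_pairs_def points_def)

lemma visits_frac: "(i, r) \<in> visits D \<Longrightarrow> frac r = r"
  by (auto simp: visits_iff double_pairs_def points_def frac_eq)

lemma crossing_param_component: "crossing_param D i r \<Longrightarrow> i < ncomps D"
  by (auto simp: crossing_param_def visits_component)

lemma crossing_param_shift: "crossing_param D i (r + of_int k) \<longleftrightarrow> crossing_param D i r"
  by (simp add: crossing_param_def frac_add_int)

lemma finite_double_pairs: "finite (double_pairs D)"
  using link_diagram by (simp add: link_diagram_def)

lemma finite_crossings: "finite (crossings D)"
  by (rule finite_subset[OF _ finite_double_pairs]) (auto simp: crossings_def)

lemma finite_visits: "finite (visits D)"
  using finite_crossings by (simp add: visits_def)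

lemma finite_crossing_params: "finite {r. a \<le> r \<and> r \<le> b \<and> crossing_param D i r}"
proof (rule finite_subset)
  show "{r. a \<le> r \<and> r \<le> b \<and> crossing_param D i r} \<subseteq>
      (\<lambda>(v, k). snd v + of_int k) ` (visits D \<times> {\<lfloor>a\<rfloor>..\<lfloor>b\<rfloor>})"
  proof
    fix r assume r: "r \<in> {r. a \<le> r \<and> r \<le> b \<and> crossing_param D i r}"
    then have "((i, frac r), \<lfloor>r\<rfloor>) \<in> visits D \<times> {\<lfloor>a\<rfloor>..\<lfloor>b\<rfloor>}"
      by (auto simp: crossing_param_def floor_mono)
    then have "(\<lambda>(v, k). snd v + of_int k) ((i, frac r), \<lfloor>r\<rfloor>) \<in>
        (\<lambda>(v, k). snd v + of_int k) ` (visits D \<times> {\<lfloor>a\<rfloor>..\<lfloor>b\<rfloor>})"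
      by (rule imageI)
    then show "r \<in> (\<lambda>(v, k). snd v + of_int k) ` (visits D \<times> {\<lfloor>a\<rfloor>..\<lfloor>b\<rfloor>})"
      by (simp add: frac_def)
  qed
qed (simp add: finite_visits)

text \<open>Parameters stay unreduced, as for arcs, so a segment may run through the base point. For
  a component with a single visit, \<open>t = s + 1\<close>.\<close>

definition consecutive :: "nat \<Rightarrow> real \<Rightarrow> real \<Rightarrow> bool" where
  "consecutive i s t \<longleftrightarrow> s < t \<and> crossing_param D i s \<and> crossing_param D i t \<and>
     (\<forall>r. s < r \<and> r < t \<longrightarrow> \<not> crossing_param D i r)"

lemma consecutive_shift:
  assumes "consecutive i s t"
  shows "consecutive i (s + of_int k) (t + of_int k)"
proof -
  have "\<not> crossing_param D i r" if "s + of_int k < r" "r < t + of_int k" for r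
    using assms that crossing_param_shift[of i r "- k"] unfolding consecutive_def
    by (auto simp: algebra_simps)
  then show ?thesis
    using assms by (simp add: consecutive_def crossing_param_shift)
qed

lemma consecutive_unique_left: "consecutive i s t \<Longrightarrow> consecutive i s' t \<Longrightarrow> s = s'"
  unfolding consecutive_def by (cases s s' rule: linorder_cases) auto

lemma consecutive_exists:
  assumes "crossing_param D i s"
  shows "\<exists>t. consecutive i s t"
proof -
  let ?S = "{r. s \<le> r \<and> r \<le> s + 1 \<and> crossing_param D i r} - {s}"
  have fin: "finite ?S" using finite_crossing_params by auto
  \<comment> \<open>Periodicity guarantees a further crossing parameter within one turn.\<close>
  have "s + 1 \<in> ?S" using assms crossing_param_shift[of i s 1] by simp
  then have "?S \<noteq> {}" by blast
  with fin have "Min ?S \<in> ?S" by (rule Min_in)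
  moreover have "\<not> crossing_param D i r" if "s < r" "r < Min ?S" for r
  proof
    assume "crossing_param D i r"
    then have "r \<in> ?S" using that \<open>Min ?S \<in> ?S\<close> by auto
    then show False using Min_le[OF fin] that(2) by fastforce
  qed
  ultimately have "consecutive i s (Min ?S)"
    using assms by (auto simp: consecutive_def)
  then show ?thesis ..
qed

lemma curve_image_shift:
  assumes i: "i < ncomps D"
  shows "curve D i ` {a + of_int k<..<b + of_int k} = curve D i ` {a<..<b}"
proof -
  have "curve D i ` {a<..<b} = (\<lambda>x. curve D i (x + of_int k)) ` {a<..<b}"
    using period[OF i] by simp
  also have "\<dots> = curve D i ` (\<lambda>x. x + of_int k) ` {a<..<b}"
    by (simp add: image_image)
  also have "(\<lambda>x. x + of_int k) ` {a<..<b} = {a + of_int k<..<b + of_int k}"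
    by (auto simp: image_iff intro!: bexI[of _ "_ - of_int k"])
  finally show ?thesis by simp
qed

text \<open>With \<open>in_segment_consecutive\<close> this identifies the segment leaving a
  crossing with the one entering the next, so that both carry the same color.\<close>

lemma out_segment_consecutive:
  assumes "consecutive i s t"
  shows "out_segment D (i, frac s) = curve D i ` {s<..<t}"
proof -
  define k where "k = - \<lfloor>s\<rfloor>"
  have k: "frac s = s + of_int k" by (simp add: k_def frac_def)
  have "consecutive i (s + of_int k) (t + of_int k)"
    by (rule consecutive_shift[OF assms])
  then have "(LEAST r. s + of_int k < r \<and> crossing_param D i r) = t + of_int k"
    unfolding consecutive_def by (intro Least_equality) (auto simp: not_less[symmetric])
  then show ?thesis
    using curve_image_shift[OF crossing_param_component, of i s] assms
    by (simp add: out_segment_def k consecutive_def)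
qed

lemma in_segment_consecutive:
  assumes "consecutive i s t"
  shows "in_segment D (i, frac t) = curve D i ` {s<..<t}"
proof -
  define k where "k = - \<lfloor>t\<rfloor>"
  have k: "frac t = t + of_int k" by (simp add: k_def frac_def)
  have "consecutive i (s + of_int k) (t + of_int k)"
    by (rule consecutive_shift[OF assms])
  then have "(GREATEST r. r < t + of_int k \<and> crossing_param D i r) = s + of_int k"
    unfolding consecutive_def by (intro Greatest_equality) (auto simp: not_less[symmetric])
  then show ?thesis
    using curve_image_shift[OF crossing_param_component, of i s] assms
    by (simp add: in_segment_def k consecutive_def)
qed

text \<open>The value \<open>f\<close> after each crossing cancels the value \<open>g\<close> before
  the next. The induction strips off the largest crossing parameter, which becomes the new right
  end.\<close>

lemma prod_telescope:
  fixes f g :: "real \<Rightarrow> 'b::field"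
  assumes "finite S" "s < t" "S = {r. s < r \<and> r < t \<and> crossing_param D i r}"
    and "crossing_param D i s" "crossing_param D i t"
    and fg: "\<And>x y. consecutive i x y \<Longrightarrow> f x = g y"
    and nz: "\<And>x. crossing_param D i x \<Longrightarrow> f x \<noteq> 0 \<and> g x \<noteq> 0"
  shows "(\<Prod>r\<in>S. f r / g r) = g t / f s"
  using assms(1-5)
proof (induction S arbitrary: t rule: finite_linorder_max_induct)
  case empty
  then have "consecutive i s t" by (auto simp: consecutive_def)
  then show ?case using fg[of s t] nz[of t] empty by simp
next
  case (insert m A)
  have mem: "r = m \<or> r \<in> A \<longleftrightarrow> s < r \<and> r < t \<and> crossing_param D i r" for r
    using arg_cong[OF insert.prems(2), of "\<lambda>B. r \<in> B"] by simp
  have m: "s < m" "m < t" "crossing_param D i m" using mem[of m] by auto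
  have A: "r \<in> A \<longleftrightarrow> s < r \<and> r < m \<and> crossing_param D i r" for r
    using mem[of r] insert.hyps(2) m(2) by fastforce
  have IH: "(\<Prod>r\<in>A. f r / g r) = g m / f s"
    by (rule insert.IH) (use A m(1,3) insert.prems(3) in blast)+
  have "\<not> crossing_param D i r" if "m < r" "r < t" for r
    using mem[of r] that m(1) insert.hyps(2) by fastforce
  then have "consecutive i m t" using m(2,3) insert.prems(4) by (simp add: consecutive_def)
  moreover have "m \<notin> A" using insert.hyps(2) by auto
  ultimately show ?case
    using IH insert.hyps(1) fg[of m t] nz[OF m(3)] by simp
qed

lemma prod_open_interval:
  fixes f g :: "real \<Rightarrow> 'b::field"
  assumes "s < t" "crossing_param D i s" "crossing_param D i t"
    and fg: "\<And>x y. consecutive i x y \<Longrightarrow> f x = g y"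
    and nz: "\<And>x. crossing_param D i x \<Longrightarrow> f x \<noteq> 0 \<and> g x \<noteq> 0"
  shows "(\<Prod>r\<in>{r \<in> {s<..<t}. crossing_param D i r}. f r / g r) = g t / f s"
proof -
  have "finite {r. s < r \<and> r < t \<and> crossing_param D i r}"
    by (rule finite_subset[OF _ finite_crossing_params[of s t i]]) auto
  from prod_telescope[OF this assms(1) refl assms(2,3), of f g] fg nz
  show ?thesis by (simp add: conj_assoc)
qed

text \<open>The circle is cut at its smallest crossing parameter \<open>m\<close>. The other
  crossings fill the open interval up to \<open>m + 1\<close>, telescope, and by periodicity cancel
  the factor at \<open>m\<close>.\<close>

lemma prod_circle:
  fixes f g :: "real \<Rightarrow> 'b::field"
  assumes ex: "crossing_param D i r0"
    and fg: "\<And>x y. consecutive i x y \<Longrightarrow> f x = g y"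
    and nz: "\<And>x. crossing_param D i x \<Longrightarrow> f x \<noteq> 0 \<and> g x \<noteq> 0"
    and per: "\<And>x. g (x + 1) = g x"
  shows "(\<Prod>r\<in>{r \<in> {0..<1}. crossing_param D i r}. f r / g r) = 1"
proof -
  let ?S = "{r \<in> {0..<1}. crossing_param D i r}"
  have fin: "finite ?S"
    by (rule finite_subset[OF _ finite_crossing_params[of 0 1 i]]) auto
  have "frac r0 \<in> ?S"
    using ex by (simp add: crossing_param_def frac_lt_1)
  then have "Min ?S \<in> ?S" using fin by (intro Min_in) auto
  define m where "m = Min ?S"
  have m: "0 \<le> m" "m < 1" "crossing_param D i m" using \<open>Min ?S \<in> ?S\<close> by (auto simp: m_def)
  have least: "m \<le> r" if "r \<in> ?S" for r unfolding m_def using fin that by (rule Min_le)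
  have "?S - {m} = {r \<in> {m<..<m + 1}. crossing_param D i r}"
  proof (intro set_eqI iffI)
    fix r assume "r \<in> ?S - {m}"
    then show "r \<in> {r \<in> {m<..<m + 1}. crossing_param D i r}"
      using least[of r] m by auto
  next
    fix r assume r: "r \<in> {r \<in> {m<..<m + 1}. crossing_param D i r}"
    \<comment> \<open>Otherwise \<open>r - 1\<close> would be a crossing parameter below the
      minimum.\<close>
    have "r < 1"
    proof (rule ccontr)
      assume "\<not> r < 1"
      then have "r - 1 \<in> ?S"
        using r m crossing_param_shift[of i r "-1"] by auto
      then show False using least[of "r - 1"] r by auto
    qed
    then show "r \<in> ?S - {m}" using r m by auto
  qed
  moreover have "(\<Prod>r\<in>{r \<in> {m<..<m + 1}. crossing_param D i r}. f r / g r) = g (m + 1) / f m"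
    by (rule prod_open_interval) (use m fg nz crossing_param_shift[of i m 1] in auto)
  moreover have "(\<Prod>r\<in>?S. f r / g r) = f m / g m * (\<Prod>r\<in>?S - {m}. f r / g r)"
    by (rule prod.remove[OF fin]) (use m in auto)
  ultimately show ?thesis using per[of m] nz[OF m(3)] by simp
qed

text \<open>Crossings sharing a strand differ at most in the order of their strands, and positivity
  of \<open>orient\<close> fixes that order. This justifies the definite description in
  \<open>crossing_of\<close>.\<close>

lemma crossing_unique:
  assumes "c \<in> crossings D" "c' \<in> crossings D" "v = fst c \<or> v = snd c" "v = fst c' \<or> v = snd c'"
  shows "c = c'"
proof -
  obtain a b a' b' where c: "c = (a, b)" "c' = (a', b')" by (cases c, cases c')
  have dp: "(a, b) \<in> double_pairs D" "(a', b') \<in> double_pairs D"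
    and o: "orient (pos D a) (vel D a) (vel D b) > 0" "orient (pos D a') (vel D a') (vel D b') > 0"
    using assms(1,2) c by (auto simp: crossings_def)
  have "pos D a = pos D b" using dp by (auto simp: double_pairs_def)
  moreover have "(a', b') = (a, b) \<or> (a', b') = (b, a)"
  proof -
    note sym = double_pairs_sym[OF dp(1)] double_pairs_sym[OF dp(2)]
    consider "a' = a" | "a' = b" | "b' = a" | "b' = b"
      using assms(3,4) unfolding c by auto
    then show ?thesis
    proof cases
      case 1 then show ?thesis using partner_unique[OF dp(1), of b'] dp(2) by simp
    next
      case 2 then show ?thesis using partner_unique[OF sym(1), of b'] dp(2) by simp
    next
      case 3 then show ?thesis using partner_unique[OF dp(1), of a'] sym(2) by simp
    next
      case 4 then show ?thesis using partner_unique[OF sym(1), of a'] sym(2) by simp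
    qed
  qed
  ultimately show ?thesis
    using o orient_skew[of "pos D a" "vel D a" "vel D b"] c by auto
qed

lemma crossing_of:
  assumes "c \<in> crossings D" "v = fst c \<or> v = snd c"
  shows "crossing_of D v = c"
  unfolding crossing_of_def
proof (rule the_equality)
  fix c' assume "c' \<in> crossings D \<and> (v = fst c' \<or> v = snd c')"
  then show "c' = c" using crossing_unique[of c' c v] assms by blast
qed (use assms in simp)

lemma crossing_strands:
  assumes "(v, w) \<in> double_pairs D"
  shows "v \<noteq> w" "over D w \<longleftrightarrow> \<not> over D v"
proof -
  show "v \<noteq> w" using assms by (simp add: double_pairs_def)
  show "over D w \<longleftrightarrow> \<not> over D v"
    using assms link_diagram unfolding link_diagram_def by blast
qed

end

text \<open>That \<open>m\<close> passes unchanged through a crossing makes the factors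
  \<open>m\<close> cancel along arcs and in the southern and eastern corners.\<close>

lemma B_map_SomeD:
  assumes "B_map (x1, x2) = Some (y2, y1)"
  shows "is_chi_color x1 \<and> is_chi_color x2 \<and> cm y1 = cm x1 \<and> cm y2 = cm x2"
  using assms unfolding B_map_def by (auto simp only: Let_def prod.case option.inject prod.inject
      option.distinct chi_color.simps split: if_split_asm)

lemma B_inv_map_SomeD:
  assumes "B_inv_map (x1, x2) = Some (y2, y1)"
  shows "is_chi_color x1 \<and> is_chi_color x2 \<and> cm y1 = cm x1 \<and> cm y2 = cm x2"
  using assms unfolding B_inv_map_def by (auto simp only: Let_def prod.case option.inject prod.inject
      option.distinct chi_color.simps split: if_split_asm)

section \<open>Colors along strands and the vertical shapes\<close>

locale colored_link = link +
  fixes col :: "(real^3) set \<Rightarrow> chi_color"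
  assumes chi_colored: "chi_colored D col"
begin

abbreviation "in_color v \<equiv> col (in_segment D v)"
abbreviation "out_color v \<equiv> col (out_segment D v)"

lemma color_at_visit:
  assumes "v \<in> visits D"
  shows "is_chi_color (in_color v)" "is_chi_color (out_color v)" "cm (out_color v) = cm (in_color v)"
proof -
  obtain c where c: "c \<in> crossings D" "v = fst c \<or> v = snd c"
    using assms by (auto simp: visits_def)
  obtain a b where ab: "c = (a, b)" by (cases c)
  have "(if crossing_sign D c = 1 then B_map else B_inv_map) (in_color a, in_color b) =
      Some (out_color b, out_color a)"
    using chi_colored c(1) by (auto simp: chi_colored_def ab)
  then show "is_chi_color (in_color v)" "cm (out_color v) = cm (in_color v)"
    using c(2) B_map_SomeD B_inv_map_SomeD by (auto simp: ab split: if_split_asm)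
  show "is_chi_color (out_color v)"
    using chi_colored assms by (auto simp: chi_colored_def segments_def)
qed

lemma color_consecutive: "consecutive i s t \<Longrightarrow> out_color (i, frac s) = in_color (i, frac t)"
  by (simp add: out_segment_consecutive in_segment_consecutive)

definition invert_unless :: "bool \<Rightarrow> complex \<Rightarrow> complex" where
  "invert_unless x z = (if x then z else inverse z)"

text \<open>Strand 1 passes over exactly at positive crossings and strand 2 exactly at negative
  ones. The crossing sign and the number of the strand thus combine into the single condition
  \<open>over D v\<close>.\<close>

lemma vertical_shapes:
  assumes "v \<in> visits D"
  shows "shape_in D (vertical_shape D col) v = invert_unless (over D v) (ca (in_color v)) / cm (in_color v)"
    and "shape_out D (vertical_shape D col) v = cm (in_color v) / invert_unless (over D v) (ca (out_color v))"
proof -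
  obtain c where c: "c \<in> crossings D" "v = fst c \<or> v = snd c"
    using assms by (auto simp: visits_def)
  obtain a b where ab: "c = (a, b)" by (cases c)
  have *: "crossing_of D v = (a, b)" "a \<noteq> b" "over D b \<longleftrightarrow> \<not> over D a"
    using crossing_of[OF c] crossing_strands[of a b] c(1) by (simp_all add: ab crossings_def)
  show "shape_in D (vertical_shape D col) v = invert_unless (over D v) (ca (in_color v)) / cm (in_color v)"
    and "shape_out D (vertical_shape D col) v = cm (in_color v) / invert_unless (over D v) (ca (out_color v))"
    using c(2) * by (auto simp: ab shape_in_def shape_out_def vertical_shape_def crossing_sign_def
        invert_unless_def power_int_minus divide_inverse mult.commute)
qed

lemma arc_equations_vertical:
  assumes comps: "\<forall>i < ncomps D. \<exists>s. (i, s) \<in> visits D"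
  shows "arc_equations D (vertical_shape D col) x"
proof -
  let ?in = "shape_in D (vertical_shape D col)" and ?out = "shape_out D (vertical_shape D col)"
  define f where "f i r = invert_unless x (ca (out_color (i, frac r)))" for i r
  define g where "g i r = invert_unless x (ca (in_color (i, frac r)))" for i r
  define m where "m i r = cm (in_color (i, frac r))" for i r
  have fg: "f i r = g i t" if "consecutive i r t" for i r t
    using color_consecutive[OF that] by (simp add: f_def g_def)
  have nz: "f i r \<noteq> 0 \<and> g i r \<noteq> 0" "m i r \<noteq> 0" "cm (out_color (i, frac r)) = m i r" if "crossing_param D i r" for i r
    using color_at_visit[of "(i, frac r)"] that
    by (auto simp: f_def g_def m_def invert_unless_def is_chi_color_def crossing_param_def)
  have inner: "inverse (?in (i, frac r) * ?out (i, frac r)) = f i r / g i r"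
    if "crossing_param D i r" "\<not> arc_end D x i r" for i r
    using vertical_shapes[of "(i, frac r)"] nz(2)[OF that(1)] that
    by (simp add: f_def g_def m_def arc_end_def crossing_param_def field_simps)
  \<comment> \<open>At an arc end the strand is of the opposite kind, so the exponent of
    \<open>a\<close> is reversed compared with the interior of the arc.\<close>
  have start: "?out (i, frac r) = m i r * f i r" and finish: "?in (i, frac r) = inverse (g i r * m i r)"
    if "arc_end D x i r" for i r
    using vertical_shapes[of "(i, frac r)"] that
    by (auto simp: f_def g_def m_def arc_end_def crossing_param_def invert_unless_def divide_inverse)
  have "?out (i, frac s) * ?in (i, frac t) *
      (\<Prod>r\<in>{r \<in> {s<..<t}. crossing_param D i r}. inverse (?in (i, frac r) * ?out (i, frac r))) = 1"
    if st: "s < t" "arc_end D x i s" "arc_end D x i t" and no: "\<forall>r\<in>{s<..<t}. \<not> arc_end D x i r" for i s t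
  proof -
    have cp: "crossing_param D i s" "crossing_param D i t" using st by (auto simp: arc_end_def)
    have "(\<Prod>r\<in>{r \<in> {s<..<t}. crossing_param D i r}. inverse (?in (i, frac r) * ?out (i, frac r))) =
        (\<Prod>r\<in>{r \<in> {s<..<t}. crossing_param D i r}. f i r / g i r)"
      by (intro prod.cong refl inner) (use no in auto)
    also have "\<dots> = g i t / f i s"
      by (rule prod_open_interval[OF st(1) cp fg]) (use nz in auto)
    finally have P: "(\<Prod>r\<in>{r \<in> {s<..<t}. crossing_param D i r}. inverse (?in (i, frac r) * ?out (i, frac r))) =
        g i t / f i s" .
    \<comment> \<open>Telescoping a product of ones carries \<open>m\<close> from \<open>s\<close>
      to \<open>t\<close>. After the factors \<open>f\<close> and \<open>g\<close> cancel, exactly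
      \<open>m i s / m i t\<close> remains.\<close>
    have "(\<Prod>r\<in>{r \<in> {s<..<t}. crossing_param D i r}. m i r / m i r) = m i t / m i s"
    proof (rule prod_open_interval[OF st(1) cp])
      show "m i r = m i y" if "consecutive i r y" for r y
        using color_consecutive[OF that] nz(3)[of i r] that by (simp add: m_def consecutive_def)
    qed (use nz in auto)
    moreover have "(\<Prod>r\<in>{r \<in> {s<..<t}. crossing_param D i r}. m i r / m i r) = 1"
      using nz(2) by (intro prod.neutral) auto
    ultimately have "m i s = m i t" using nz(2)[OF cp(1)] by simp
    then show ?thesis
      unfolding P start[OF st(2)] finish[OF st(3)]
      using nz[OF cp(1)] nz[OF cp(2)] by (simp add: field_simps)
  qed
  moreover have "(\<Prod>r\<in>{r \<in> {0..<1}. crossing_param D i r}. inverse (?in (i, frac r) * ?out (i, frac r))) = 1"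
    if i: "i < ncomps D" and no: "\<forall>r. \<not> arc_end D x i r" for i
  proof -
    obtain s where "(i, s) \<in> visits D" using comps i by blast
    then have s: "crossing_param D i s" using visits_frac by (simp add: crossing_param_def)
    have "(\<Prod>r\<in>{r \<in> {0..<1}. crossing_param D i r}. inverse (?in (i, frac r) * ?out (i, frac r))) =
        (\<Prod>r\<in>{r \<in> {0..<1}. crossing_param D i r}. f i r / g i r)"
      by (intro prod.cong refl inner) (use no in auto)
    also have "\<dots> = 1"
      by (rule prod_circle[OF s fg]) (use nz frac_add_int[of _ 1] in \<open>auto simp: g_def\<close>)
    finally show ?thesis .
  qed
  ultimately show ?thesis
    unfolding arc_equations_def by blast
qed

end

section \<open>Region equations\<close>

lemma corner_in_germ_in: "corner_in D c k R \<longleftrightarrow> germ_in (pos D (fst c)) (corner_vec D c k) R"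
  by (simp add: corner_in_def germ_in_def)

context link
begin

section \<open>Corners seen from a strand, and the successor of a visit\<close>

definition partner :: "nat \<times> real \<Rightarrow> nat \<times> real" where
  "partner v = (THE w. (v, w) \<in> double_pairs D)"

lemma partner_eq: "(v, w) \<in> double_pairs D \<Longrightarrow> partner v = w"
  unfolding partner_def by (rule the_equality) (auto dest: partner_unique)

text \<open>At a visit this is 1 on strand 1 of its crossing and -1 on strand 2.\<close>

definition crossing_side :: "nat \<times> real \<Rightarrow> real" where
  "crossing_side v = (if orient (pos D v) (vel D v) (vel D (partner v)) > 0 then 1 else -1)"

text \<open>
  The velocity of the other strand, reversed if necessary so that it points to the left of the
  strand through \<open>v\<close>.
\<close>

definition leftward :: "nat \<times> real \<Rightarrow> real^3" where
  "leftward v = crossing_side v *\<^sub>R vel D (partner v)"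

text \<open>The corner beside the outgoing half-segment at \<open>v\<close>, on its left for
  \<open>\<kappa> = 1\<close> and on its right for \<open>\<kappa> = -1\<close>;
  \<open>in_germ\<close> does the same for the incoming half.\<close>

definition out_germ :: "real \<Rightarrow> nat \<times> real \<Rightarrow> (real^3) set \<Rightarrow> bool" where
  "out_germ \<kappa> v R \<longleftrightarrow> germ_in (pos D v) (vel D v + \<kappa> *\<^sub>R leftward v) R"

definition in_germ :: "real \<Rightarrow> nat \<times> real \<Rightarrow> (real^3) set \<Rightarrow> bool" where
  "in_germ \<kappa> v R \<longleftrightarrow> germ_in (pos D v) (- vel D v + \<kappa> *\<^sub>R leftward v) R"

text \<open>Every corner is bounded by one half-segment of each strand. It is read here from strand
  1 and in \<open>corner_in_strand2\<close> from strand 2, so that its shape can be split between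
  the two.\<close>

lemma corner_in_strand1:
  assumes "(v, w) \<in> crossings D"
  shows "corner_in D (v, w) North R \<longleftrightarrow> in_germ 1 v R" "corner_in D (v, w) West R \<longleftrightarrow> in_germ (-1) v R"
    "corner_in D (v, w) South R \<longleftrightarrow> out_germ (-1) v R" "corner_in D (v, w) East R \<longleftrightarrow> out_germ 1 v R"
proof -
  have "leftward v = vel D w"
    using assms by (auto simp: leftward_def crossing_side_def crossings_def partner_eq)
  then show "corner_in D (v, w) North R \<longleftrightarrow> in_germ 1 v R" "corner_in D (v, w) West R \<longleftrightarrow> in_germ (-1) v R"
    "corner_in D (v, w) South R \<longleftrightarrow> out_germ (-1) v R" "corner_in D (v, w) East R \<longleftrightarrow> out_germ 1 v R"
    by (simp_all add: corner_in_germ_in in_germ_def out_germ_def)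
qed

lemma corner_in_strand2:
  assumes "(v, w) \<in> crossings D"
  shows "corner_in D (v, w) North R \<longleftrightarrow> out_germ 1 w R" "corner_in D (v, w) West R \<longleftrightarrow> in_germ 1 w R"
    "corner_in D (v, w) South R \<longleftrightarrow> in_germ (-1) w R" "corner_in D (v, w) East R \<longleftrightarrow> out_germ (-1) w R"
proof -
  have dp: "(v, w) \<in> double_pairs D" and o: "orient (pos D v) (vel D v) (vel D w) > 0"
    using assms by (auto simp: crossings_def)
  then have pos: "pos D w = pos D v" by (auto simp: double_pairs_def)
  have "leftward w = - vel D v"
    using o orient_skew[of "pos D v" "vel D v" "vel D w"]
    by (simp add: leftward_def crossing_side_def partner_eq[OF double_pairs_sym[OF dp]] pos)
  then show "corner_in D (v, w) North R \<longleftrightarrow> out_germ 1 w R" "corner_in D (v, w) West R \<longleftrightarrow> in_germ 1 w R"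
    "corner_in D (v, w) South R \<longleftrightarrow> in_germ (-1) w R" "corner_in D (v, w) East R \<longleftrightarrow> out_germ (-1) w R"
    by (simp_all add: corner_in_germ_in in_germ_def out_germ_def pos algebra_simps)
qed

definition next_visit :: "nat \<times> real \<Rightarrow> nat \<times> real" where
  "next_visit v = (fst v, frac (SOME t. consecutive (fst v) (snd v) t))"

lemma next_visit:
  assumes "v \<in> visits D"
  obtains i s t where "v = (i, frac s)" "frac s = s" "consecutive i s t" "next_visit v = (i, frac t)"
proof -
  obtain i s where v: "v = (i, s)" by (cases v)
  then have s: "frac s = s" using visits_frac assms by blast
  then have "crossing_param D i s" using assms by (simp add: v crossing_param_def)
  then have "consecutive i s (SOME t. consecutive i s t)"
    using consecutive_exists by (metis someI_ex)
  then show thesis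
    by (rule that[of i s, rotated 2]) (simp_all add: v s next_visit_def)
qed

text \<open>A crossing parameter has at most one predecessor, so the map is injective, and an
  injective self-map of a finite set is onto.\<close>

lemma bij_betw_next_visit: "bij_betw next_visit (visits D) (visits D)"
proof -
  have "inj_on next_visit (visits D)"
  proof (rule inj_onI)
    fix v v' assume v: "v \<in> visits D" "v' \<in> visits D" and eq: "next_visit v = next_visit v'"
    obtain i s t where 1: "v = (i, frac s)" "frac s = s" "consecutive i s t" "next_visit v = (i, frac t)"
      using next_visit[OF v(1)] .
    obtain i' s' t' where 2: "v' = (i', frac s')" "frac s' = s'" "consecutive i' s' t'" "next_visit v' = (i', frac t')"
      using next_visit[OF v(2)] .
    have i: "i' = i" and "frac t = frac t'" using eq 1 2 by auto
    \<comment> \<open>The two lifts of the common end differ by an integer; after shifting by it,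
      both segments end at \<open>t'\<close>.\<close>
    then have t: "t' = t + of_int (\<lfloor>t'\<rfloor> - \<lfloor>t\<rfloor>)" by (simp add: frac_def algebra_simps)
    have "consecutive i (s + of_int (\<lfloor>t'\<rfloor> - \<lfloor>t\<rfloor>)) t'"
      by (subst t) (rule consecutive_shift[OF 1(3)])
    with 2(3) i have "s' = s + of_int (\<lfloor>t'\<rfloor> - \<lfloor>t\<rfloor>)"
      using consecutive_unique_left by blast
    then have "frac s' = frac s" by (simp only: frac_add_int)
    then show "v = v'" using 1(1) 2(1) i by simp
  qed
  moreover have "next_visit ` visits D \<subseteq> visits D"
  proof
    fix w assume "w \<in> next_visit ` visits D"
    then obtain v where v: "v \<in> visits D" "w = next_visit v" by blast
    obtain i s t where "consecutive i s t" "next_visit v = (i, frac t)"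
      using next_visit[OF v(1)] by metis
    then show "w \<in> visits D" by (simp add: v consecutive_def crossing_param_def)
  qed
  ultimately show ?thesis
    using endo_inj_surj[OF finite_visits] by (simp add: bij_betw_def)
qed

text \<open>\<open>segment_sides\<close> in the language of visits: the two corners on a given side
  of a segment belong to the same region.\<close>

lemma out_germ_next_visit:
  assumes v: "v \<in> visits D" and R: "R \<in> regions D" and k: "\<bar>\<kappa>\<bar> = 1"
  shows "out_germ \<kappa> v R \<longleftrightarrow> in_germ \<kappa> (next_visit v) R"
proof -
  obtain i s t where 1: "v = (i, frac s)" "consecutive i s t" "next_visit v = (i, frac t)"
    using next_visit[OF v] by metis
  have i: "i < ncomps D" using v 1(1) visits_component by blast
  \<comment> \<open>Presents the other strand at a crossing by a component and a parameter, together
    with the sign that turns its velocity to the left.\<close>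
  have *: "\<exists>j s'. j < ncomps D \<and> ((i, frac r), (j, frac s')) \<in> double_pairs D \<and>
      leftward (i, frac r) = crossing_side (i, frac r) *\<^sub>R tangent j s' \<and>
      crossing_side (i, frac r) * orient (curve D i r) (tangent i r) (tangent j s') > 0"
    if "crossing_param D i r" for r
  proof -
    have "\<exists>w. ((i, frac r), w) \<in> double_pairs D"
      using that unfolding crossing_param_def visits_iff .
    then obtain w where w: "((i, frac r), w) \<in> double_pairs D" ..
    obtain j s' where "w = (j, s')" by (cases w)
    with w have dp: "((i, frac r), (j, s')) \<in> double_pairs D" by (simp only:)
    have v': "(j, s') \<in> visits D" unfolding visits_iff using double_pairs_sym[OF dp] ..
    have j: "j < ncomps D" "frac s' = s'"
      by (rule visits_component[OF v']) (rule visits_frac[OF v'])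
    then have "vel D (partner (i, frac r)) = tangent j s'"
      using vel_frac[of j s'] by (simp add: partner_eq[OF dp])
    moreover from this have "crossing_side (i, frac r) * orient (curve D i r) (tangent i r) (tangent j s') > 0"
      using orient_crossing[OF dp] vel_frac[of j s'] j
      by (simp add: crossing_side_def vel_frac pos_frac i)
    ultimately show ?thesis
      using j dp by (intro exI[of _ j] exI[of _ s']) (simp add: leftward_def)
  qed
  obtain j s' where s': "j < ncomps D" "((i, frac s), (j, frac s')) \<in> double_pairs D"
      "leftward (i, frac s) = crossing_side (i, frac s) *\<^sub>R tangent j s'"
      "crossing_side (i, frac s) * orient (curve D i s) (tangent i s) (tangent j s') > 0"
    using *[of s] 1(2) unfolding consecutive_def by blast
  obtain l t' where t': "l < ncomps D" "((i, frac t), (l, frac t')) \<in> double_pairs D"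
      "leftward (i, frac t) = crossing_side (i, frac t) *\<^sub>R tangent l t'"
      "crossing_side (i, frac t) * orient (curve D i t) (tangent i t) (tangent l t') > 0"
    using *[of t] 1(2) unfolding consecutive_def by blast
  \<comment> \<open>Taking \<open>c = \<kappa>\<close> in \<open>segment_sides\<close> produces the
    square of \<open>\<kappa>\<close>, which reduces both side conditions to the leftward
    ones.\<close>
  have "\<kappa> * \<kappa> = 1" using k abs_mult_self_eq[of \<kappa>] by simp
  then have kk: "\<kappa> * (\<kappa> * x) * y = x * y" for x y by (simp add: mult.assoc[symmetric])
  have abs: "\<bar>\<kappa> * crossing_side x\<bar> = 1" for x
    using k by (simp add: abs_mult crossing_side_def)
  have "germ_in (curve D i s) (tangent i s + (\<kappa> * crossing_side (i, frac s)) *\<^sub>R tangent j s') R \<longleftrightarrow>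
      germ_in (curve D i t) (- tangent i t + (\<kappa> * crossing_side (i, frac t)) *\<^sub>R tangent l t') R"
    by (rule segment_sides[OF i _ _ R s'(1,2) abs t'(1,2) abs, where c = \<kappa>], unfold kk)
      (use 1(2) s'(4) t'(4) in \<open>simp_all add: consecutive_def\<close>)
  then show ?thesis
    unfolding 1(3) unfolding 1(1)
    by (simp add: out_germ_def in_germ_def s'(3) t'(3) vel_frac pos_frac i)
qed

text \<open>Each visit is a strand of exactly one crossing, and the first strands are disjoint from
  the second ones.\<close>

lemma prod_crossings_strands:
  fixes T :: "nat \<times> real \<Rightarrow> complex"
  shows "(\<Prod>c\<in>crossings D. T (fst c) * T (snd c)) = (\<Prod>v\<in>visits D. T v)"
proof -
  have "c = c'" if "c \<in> crossings D" "c' \<in> crossings D" "fst c = fst c' \<or> snd c = snd c'" for c c'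
    using crossing_unique[OF that(1,2), of "fst c"] crossing_unique[OF that(1,2), of "snd c"] that(3)
    by simp blast
  then have "inj_on fst (crossings D)" "inj_on snd (crossings D)"
    by (simp_all add: inj_on_def)
  moreover have "fst ` crossings D \<inter> snd ` crossings D = {}"
  proof (rule ccontr)
    assume "fst ` crossings D \<inter> snd ` crossings D \<noteq> {}"
    then obtain x where "x \<in> fst ` crossings D" "x \<in> snd ` crossings D" by blast
    then obtain c c' where c: "c \<in> crossings D" "c' \<in> crossings D" "x = fst c" "x = snd c'" by blast
    then have "c = c'" using crossing_unique[of c c' x] by simp
    with c show False using crossing_strands(1)[of "fst c" "snd c"] by (auto simp: crossings_def)
  qed
  ultimately show ?thesis
    using finite_crossings
    by (simp add: visits_def prod.union_disjoint prod.reindex prod.distrib)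
qed

end

section \<open>Splitting the horizontal shapes into weights of half-segments\<close>

context colored_link
begin

text \<open>
  The factor of a segment in the shapes of the corners on its left (\<open>\<kappa> = 1\<close>) or right
  (\<open>\<kappa> = -1\<close>) at its starting point; at its end point it contributes the inverse.
\<close>

definition side_weight :: "real \<Rightarrow> chi_color \<Rightarrow> complex" where
  "side_weight \<kappa> x = (if \<kappa> = 1 then cb x else 1 / (cm x * cb x))"

definition out_factor :: "(real^3) set \<Rightarrow> real \<Rightarrow> nat \<times> real \<Rightarrow> complex" where
  "out_factor R \<kappa> v = (if out_germ \<kappa> v R then side_weight \<kappa> (out_color v) else 1)"

definition in_factor :: "(real^3) set \<Rightarrow> real \<Rightarrow> nat \<times> real \<Rightarrow> complex" where
  "in_factor R \<kappa> v = (if in_germ \<kappa> v R then 1 / side_weight \<kappa> (in_color v) else 1)"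

text \<open>Reindexing the incoming factors by \<open>next_visit\<close> sets the two ends of each
  segment side by side. Either both of their corners lie in \<open>R\<close> or neither does, and
  their weights are inverse.\<close>

lemma prod_side_factors:
  assumes R: "R \<in> regions D" and k: "\<bar>\<kappa>\<bar> = 1"
  shows "(\<Prod>v\<in>visits D. out_factor R \<kappa> v * in_factor R \<kappa> v) = 1"
proof -
  have "(\<Prod>v\<in>visits D. in_factor R \<kappa> v) = (\<Prod>v\<in>visits D. in_factor R \<kappa> (next_visit v))"
    by (rule prod.reindex_bij_betw[OF bij_betw_next_visit, symmetric])
  then have "(\<Prod>v\<in>visits D. out_factor R \<kappa> v * in_factor R \<kappa> v) =
      (\<Prod>v\<in>visits D. out_factor R \<kappa> v * in_factor R \<kappa> (next_visit v))"
    by (simp add: prod.distrib)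
  also have "\<dots> = 1"
  proof (rule prod.neutral, rule ballI)
    fix v assume v: "v \<in> visits D"
    obtain i s t where 1: "v = (i, frac s)" "consecutive i s t" "next_visit v = (i, frac t)"
      using next_visit[OF v] by metis
    have "side_weight \<kappa> (out_color v) \<noteq> 0"
      using color_at_visit(2)[OF v] by (simp add: side_weight_def is_chi_color_def)
    moreover have "out_color v = in_color (next_visit v)"
      unfolding 1(3) unfolding 1(1) by (rule color_consecutive[OF 1(2)])
    ultimately show "out_factor R \<kappa> v * in_factor R \<kappa> (next_visit v) = 1"
      using out_germ_next_visit[OF v R k] by (simp add: out_factor_def in_factor_def)
  qed
  finally show ?thesis .
qed

lemma region_equations_horizontal: "region_equations D (horizontal_shape D col)"
  unfolding region_equations_def
proof
  fix R assume R: "R \<in> regions D"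
  let ?h = "horizontal_shape D col"
  \<comment> \<open>The four half-segment factors at one visit. The four corners of a crossing use
    the eight factors of its two strands exactly once each.\<close>
  define T where "T v = (out_factor R 1 v * in_factor R 1 v) * (out_factor R (-1) v * in_factor R (-1) v)" for v
  have corners: "UNIV = {North, West, South, East}"
    using corner.exhaust by auto
  then have fin: "finite (UNIV :: corner set)" by (metis finite.emptyI finite.insertI)
  have prod_corners: "(\<Prod>k\<in>UNIV. F k) = F North * F West * F South * F East" for F :: "corner \<Rightarrow> complex"
    unfolding corners by simp
  have "(\<Prod>(c, k)\<in>{(c, k). c \<in> crossings D \<and> corner_in D c k R}. ?h c k) =
      (\<Prod>(c, k)\<in>crossings D \<times> UNIV. if corner_in D c k R then ?h c k else 1)"
    by (rule prod.mono_neutral_cong_left) (use finite_crossings fin in \<open>auto split: if_splits\<close>)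
  also have "\<dots> = (\<Prod>c\<in>crossings D. \<Prod>k\<in>UNIV. if corner_in D c k R then ?h c k else 1)"
    by (rule prod.cartesian_product[symmetric])
  also have "\<dots> = (\<Prod>c\<in>crossings D. T (fst c) * T (snd c))"
  proof (rule prod.cong[OF refl])
    fix c assume c: "c \<in> crossings D"
    obtain v w where vw: "c = (v, w)" by (cases c)
    then have "v \<in> visits D" "w \<in> visits D" using c by (force simp: visits_def)+
    note col = color_at_visit(3)[OF this(1)] color_at_visit(3)[OF this(2)]
    note c' = c[unfolded vw]
    show "(\<Prod>k\<in>UNIV. if corner_in D c k R then ?h c k else 1) = T (fst c) * T (snd c)"
    proof -
      \<comment> \<open>For instance \<open>b\<^sub>2\<^sub>' / b\<^sub>1\<close> is the left weight
        at the start of \<open>2'\<close> times the inverse left weight at the end of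
        \<open>1\<close>.\<close>
      have N: "(if corner_in D c North R then ?h c North else 1) = out_factor R 1 w * in_factor R 1 v"
        using corner_in_strand1(1)[OF c', of R] corner_in_strand2(1)[OF c', of R]
        by (simp add: vw out_factor_def in_factor_def side_weight_def horizontal_shape_def)
      have W: "(if corner_in D c West R then ?h c West else 1) = in_factor R (-1) v * in_factor R 1 w"
        using corner_in_strand1(2)[OF c', of R] corner_in_strand2(2)[OF c', of R]
        by (simp add: vw out_factor_def in_factor_def side_weight_def horizontal_shape_def)
      \<comment> \<open>South and east involve right weights of outgoing segments, whose
        \<open>m\<close> is replaced by the incoming one through \<open>col\<close>.\<close>
      have S: "(if corner_in D c South R then ?h c South else 1) = out_factor R (-1) v * in_factor R (-1) w"
        using corner_in_strand1(3)[OF c', of R] corner_in_strand2(3)[OF c', of R]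
        by (simp add: vw out_factor_def in_factor_def side_weight_def horizontal_shape_def col)
      have E: "(if corner_in D c East R then ?h c East else 1) = out_factor R 1 v * out_factor R (-1) w"
        using corner_in_strand1(4)[OF c', of R] corner_in_strand2(4)[OF c', of R]
        by (simp add: vw out_factor_def in_factor_def side_weight_def horizontal_shape_def col)
      show ?thesis
        unfolding prod_corners N W S E T_def by (simp add: vw)
    qed
  qed
  also have "\<dots> = (\<Prod>v\<in>visits D. T v)" by (rule prod_crossings_strands)
  also have "\<dots> = 1"
    unfolding T_def prod.distrib[of "\<lambda>v. out_factor R 1 v * in_factor R 1 v"]
    using prod_side_factors[OF R, of 1] prod_side_factors[OF R, of "-1"] by simp
  finally show "(\<Prod>(c, k)\<in>{(c, k). c \<in> crossings D \<and> corner_in D c k R}. ?h c k) = 1" .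
qed

end

theorem theorem4p2:
  fixes D :: diagram and col :: "(real^3) set \<Rightarrow> chi_color"
  assumes "link_diagram D"
    and "\<forall>i < ncomps D. \<exists>s. (i, s) \<in> visits D"
    and "chi_colored D col"
  shows "gluing_equations D (vertical_shape D col) (horizontal_shape D col)"
proof -
  interpret colored_link D col
    by standard (use assms in simp_all)
  show ?thesis
    unfolding gluing_equations_def
    using region_equations_horizontal arc_equations_vertical[OF assms(2)] by blast
qed

end
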